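(* Let $\delta=a+b+c$. If one of $$-a,\ -b,\ -c,\quad a+g/2+1,\ b+g/2+1,\ c+g/2+1,\quad -(\delta+g/2+1),\ \delta+g+2,\quad 1/2-g/2,$$ $$e_i-r\ (1\le i\le6),\quad e_7,\ e_8,\ e_9,\quad r$$ is an integer, then the equation $S\!E_6(a,b,c,g,p,q,r)$ is reducible.
   Context: Notation: $\partial=d/dx$, $\theta=x\partial$; $a,b,c,g,p,q,r$ are complex parameters. The operator $E_6(e_1,\dots,e_9)$: put $s=(6-e_1-\cdots-e_9)/3$ and $s_{11}=e_1+e_2+e_3$, $s_{12}=e_4+e_5+e_6$, $s_{13}=e_7+e_8+e_9$, $s_{21}=e_1e_2+e_1e_3+e_2e_3$, $s_{22}=e_4e_5+e_4e_6+e_5e_6$, $s_{23}=e_7e_8+e_7e_9+e_8e_9$, $s_{31}=e_1e_2e_3$, $s_{32}=e_4e_5e_6$, $s_{33}=e_7e_8e_9$. Then $E_6=T_0+T_1\partial+T_2\partial^2+T_3\partial^3$ with $T_0=(\theta+s+2)(\theta+s+1)(\theta+s)(\theta+e_7)(\theta+e_8)(\theta+e_9)$, $T_1=(\theta+s+2)(\theta+s+1)B_1$, $B_1=T_{13}\theta^3+T_{12}\theta^2+T_{11}\theta+T_{10}$, $T_2=(\theta+s+2)B_2$, $B_2=T_{23}\theta^3+T_{22}\theta^2+T_{21}\theta+T_{20}$, $T_3=-(\theta+3-e_1)(\theta+3-e_2)(\theta+3-e_3)$, where $T_{13}=-3$, $T_{23}=3$, $T_{12}=-9+s_{11}-2s_{13}$,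 $T_{22}=18+s_{13}-2s_{11}$, $T_{11}=-8+(s_{11}^2+2s_{11}s_{13}-s_{12}^2+s_{13}^2)/3+s_{11}-5s_{13}-s_{21}+s_{22}-2s_{23}$, $T_{21}=35+(-s_{11}^2-2s_{11}s_{13}+s_{12}^2-s_{13}^2)/3-7s_{11}+5s_{13}+2s_{21}-s_{22}+s_{23}$, $T_{20}=-T_{10}+19+(s_{11}^2s_{13}-s_{11}s_{12}^2+s_{11}s_{13}^2-s_{12}^2s_{13})/9+(s_{13}^3+s_{11}^3-2s_{12}^3)/27+(-2s_{11}^2-4s_{11}s_{13}+s_{11}s_{22}+2s_{12}^2+s_{22}s_{12}-2s_{13}^2+s_{22}s_{13})/3-5s_{11}+4s_{13}+3s_{21}-2s_{22}-s_{31}-s_{32}-s_{33}$, $2T_{10}=(2s_{11}+s_{11}^2+2s_{11}s_{13}-s_{12}^2+s_{13}^2-s_{11}s_{21}+2s_{11}s_{23}+s_{12}s_{22}-2s_{13}s_{21}+2s_{13}s_{22}+s_{13}s_{23}-14s_{13})/3+2(s_{11}^2s_{13}-s_{12}^2s_{13})/9+2(s_{11}^3-s_{12}^3)/27-5-s_{21}+s_{31}+s_{22}-s_{32}-5s_{23}-3s_{33}$. The operator $S\!E_6(a,b,c,g,p,q,r)$ is $E_6(e_1,\dots,e_9)$ with $e_1=p+r+1$, $e_2=a+c+p+r+2$, $e_3=2a+2c+g+p+r+3$, $e_4=q+r+1$, $e_5=b+c+q+r+2$, $e_6=2b+2c+g+q+r+3$, $e_7=-2c-(p+q+r)-1$,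 $e_8=-\delta-c-(p+q+r+g)-2$, $e_9=-2\delta-(p+q+r+g)-3$; then $s=-r$. An operator $E\in\mathbb C(x)[\partial]$ is reducible if $E=F_1\circ F_2$ with $F_1,F_2\in\mathbb C(x)[\partial]$ of positive order. *)

theory Defs
  imports
    Complex_Main
    "HOL-Computational_Algebra.Polynomial"
    "HOL-Computational_Algebra.Fraction_Field"
begin

section \<open>The differential field of rational functions\<close>

type_synonym ratfun = "complex poly fract"

lift_definition ratfun_deriv :: "ratfun \<Rightarrow> ratfun"
  is "\<lambda>f. (pderiv (fst f) * snd f - fst f * pderiv (snd f), snd f * snd f)"
proof (clarsimp simp: fractrel_def)
  fix a b c d :: "complex poly"
  assume nz: "b \<noteq> 0" "d \<noteq> 0" and eq: "a * d = c * b"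
  have "pderiv (a * d) = pderiv (c * b)"
    by (simp add: eq)
  then have der: "a * pderiv d + d * pderiv a = c * pderiv b + b * pderiv c"
    by (simp add: pderiv_mult)
  have "(pderiv a * b - a * pderiv b) * (d * d)
      = b * d * (a * pderiv d + d * pderiv a)
        - (a * d) * (b * pderiv d + d * pderiv b)"
    by (simp add: algebra_simps)
  also have "\<dots> = b * d * (c * pderiv b + b * pderiv c)
        - (c * b) * (b * pderiv d + d * pderiv b)"
    by (simp only: der eq)
  also have "\<dots> = (pderiv c * d - c * pderiv d) * (b * b)"
    by (simp add: algebra_simps)
  finally show "(pderiv a * b - a * pderiv b) * (d * d) = (pderiv c * d - c * pderiv d) * (b * b)" .
qed

lemma ratfun_deriv_Fract:
  "q \<noteq> 0 \<Longrightarrow> ratfun_deriv (Fract p q) = Fract (pderiv p * q - p * pderiv q) (q * q)"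
  by transfer simp

lemma ratfun_deriv_0 [simp]: "ratfun_deriv 0 = 0"
  by (simp add: fract_expand ratfun_deriv_Fract)

lemma ratfun_deriv_1 [simp]: "ratfun_deriv 1 = 0"
  by (simp add: fract_expand ratfun_deriv_Fract)

lemma ratfun_deriv_add: "ratfun_deriv (f + g) = ratfun_deriv f + ratfun_deriv g"
  by (cases f, cases g) (simp add: ratfun_deriv_Fract eq_fract pderiv_mult pderiv_add algebra_simps)

lemma ratfun_deriv_mult: "ratfun_deriv (f * g) = ratfun_deriv f * g + f * ratfun_deriv g"
  by (cases f, cases g) (simp add: ratfun_deriv_Fract eq_fract pderiv_mult algebra_simps)


section \<open>The ring of ordinary differential operators with rational coefficients\<close>

text \<open>
  The operator $\sum_i a_i \partial^i$ is represented by the polynomial with coefficients $a_i$,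
  the indeterminate standing for $\partial$ and coefficients being written on the left.
\<close>

typedef diffop = "UNIV :: ratfun poly set"
  morphisms symbol Diffop by simp

setup_lifting type_definition_diffop

text \<open>Left composition with $\partial$:
  $\partial \circ \sum_i a_i \partial^i = \sum_i (a_i \partial^{i+1} + a_i' \partial^i)$.\<close>

definition D_comp :: "ratfun poly \<Rightarrow> ratfun poly" where
  "D_comp Q = pCons 0 Q + map_poly ratfun_deriv Q"

definition op_comp :: "ratfun poly \<Rightarrow> ratfun poly \<Rightarrow> ratfun poly" where
  "op_comp P Q = (\<Sum>i\<le>degree P. smult (coeff P i) ((D_comp ^^ i) Q))"

lemma D_comp_0 [simp]: "D_comp 0 = 0"
  by (simp add: D_comp_def)

lemma D_comp_add: "D_comp (P + Q) = D_comp P + D_comp Q"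
  by (rule poly_eqI)
    (simp add: D_comp_def coeff_map_poly ratfun_deriv_add coeff_pCons split: nat.split)

lemma D_comp_smult: "D_comp (smult f P) = smult f (D_comp P) + smult (ratfun_deriv f) P"
  by (rule poly_eqI)
    (simp add: D_comp_def coeff_map_poly ratfun_deriv_mult coeff_pCons algebra_simps split: nat.split)

lemma D_comp_sum: "D_comp (\<Sum>i\<in>A. f i) = (\<Sum>i\<in>A. D_comp (f i))"
  by (induction A rule: infinite_finite_induct) (simp_all add: D_comp_add)

lemma D_comp_pow_0 [simp]: "(D_comp ^^ i) 0 = 0"
  by (induction i) simp_all

lemma D_comp_pow_add: "(D_comp ^^ i) (P + Q) = (D_comp ^^ i) P + (D_comp ^^ i) Q"
  by (induction i) (simp_all add: D_comp_add)

lemma D_comp_pow_1: "(D_comp ^^ i) 1 = monom 1 i"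
proof (induction i)
  case (Suc i)
  have "map_poly ratfun_deriv (monom 1 i) = 0"
    by (rule poly_eqI) (simp add: coeff_map_poly coeff_monom)
  then show ?case
    using Suc by (simp add: D_comp_def monom_Suc)
qed (simp add: monom_0)

lemma op_comp_extend:
  assumes "degree P \<le> n"
  shows "op_comp P Q = (\<Sum>i\<le>n. smult (coeff P i) ((D_comp ^^ i) Q))"
  unfolding op_comp_def using assms
  by (intro sum.mono_neutral_left) (auto simp: coeff_eq_0)

lemma op_comp_add_left: "op_comp (P + Q) R = op_comp P R + op_comp Q R"
proof -
  let ?n = "max (degree P) (degree Q)"
  have "degree (P + Q) \<le> ?n"
    by (rule degree_add_le_max)
  then show ?thesis
    by (simp add: op_comp_extend[of _ ?n] smult_add_left sum.distrib)
qed

lemma op_comp_add_right: "op_comp P (Q + R) = op_comp P Q + op_comp P R"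
  by (simp add: op_comp_def D_comp_pow_add smult_add_right sum.distrib)

lemma op_comp_0_left [simp]: "op_comp 0 Q = 0"
  by (simp add: op_comp_def)

lemma op_comp_sum_left: "op_comp (\<Sum>i\<in>A. f i) R = (\<Sum>i\<in>A. op_comp (f i) R)"
  by (induction A rule: infinite_finite_induct) (simp_all add: op_comp_add_left)

lemma smult_sum_right:
  fixes f :: ratfun and h :: "'i \<Rightarrow> ratfun poly"
  shows "smult f (\<Sum>i\<in>A. h i) = (\<Sum>i\<in>A. smult f (h i))"
  by (induction A rule: infinite_finite_induct) (simp_all add: smult_add_right)

lemma op_comp_smult_left: "op_comp (smult f P) R = smult f (op_comp P R)"
proof -
  have "op_comp (smult f P) R = (\<Sum>i\<le>degree P. smult (coeff (smult f P) i) ((D_comp ^^ i) R))"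
    by (rule op_comp_extend) (rule degree_smult_le)
  also have "\<dots> = (\<Sum>i\<le>degree P. smult f (smult (coeff P i) ((D_comp ^^ i) R)))"
    by simp
  also have "\<dots> = smult f (op_comp P R)"
    unfolding op_comp_def by (simp only: smult_sum_right)
  finally show ?thesis .
qed

lemma op_comp_D_left: "op_comp (D_comp P) R = D_comp (op_comp P R)"
proof -
  have deg1: "degree (pCons 0 P) \<le> Suc (degree P)"
    by (rule degree_pCons_le)
  have deg2: "degree (map_poly ratfun_deriv P) \<le> degree P"
    by (rule degree_le) (simp add: coeff_map_poly coeff_eq_0)
  have "op_comp (D_comp P) R
      = op_comp (pCons 0 P) R + op_comp (map_poly ratfun_deriv P) R"
    by (simp add: D_comp_def op_comp_add_left)
  also have "op_comp (pCons 0 P) R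
      = (\<Sum>i\<le>degree P. smult (coeff P i) (D_comp ((D_comp ^^ i) R)))"
    by (subst op_comp_extend[OF deg1], subst sum.atMost_Suc_shift) simp
  also have "op_comp (map_poly ratfun_deriv P) R
      = (\<Sum>i\<le>degree P. smult (ratfun_deriv (coeff P i)) ((D_comp ^^ i) R))"
    by (subst op_comp_extend[OF deg2]) (simp add: coeff_map_poly)
  also have "(\<Sum>i\<le>degree P. smult (coeff P i) (D_comp ((D_comp ^^ i) R))) + \<dots>
      = D_comp (op_comp P R)"
    by (simp add: op_comp_def D_comp_sum D_comp_smult sum.distrib)
  finally show ?thesis .
qed

lemma op_comp_assoc: "op_comp (op_comp P Q) R = op_comp P (op_comp Q R)"
proof -
  have D_pow: "op_comp ((D_comp ^^ i) Q) R = (D_comp ^^ i) (op_comp Q R)" for i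
    by (induction i) (simp_all add: op_comp_D_left)
  have "op_comp (op_comp P Q) R
      = op_comp (\<Sum>i\<le>degree P. smult (coeff P i) ((D_comp ^^ i) Q)) R"
    by (simp only: op_comp_def[of P Q])
  also have "\<dots> = (\<Sum>i\<le>degree P. smult (coeff P i) ((D_comp ^^ i) (op_comp Q R)))"
    by (simp add: op_comp_sum_left op_comp_smult_left D_pow)
  finally show ?thesis
    by (simp only: op_comp_def[of P "op_comp Q R"])
qed

lemma op_comp_1_left: "op_comp 1 Q = Q"
  by (simp add: op_comp_def)

lemma op_comp_1_right: "op_comp P 1 = P"
  by (simp add: op_comp_def D_comp_pow_1 smult_monom poly_as_sum_of_monoms)

instantiation diffop :: ring_1
begin

lift_definition zero_diffop :: diffop is 0 .
lift_definition one_diffop :: diffop is 1 .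
lift_definition plus_diffop :: "diffop \<Rightarrow> diffop \<Rightarrow> diffop" is "(+)" .
lift_definition minus_diffop :: "diffop \<Rightarrow> diffop \<Rightarrow> diffop" is "(-)" .
lift_definition uminus_diffop :: "diffop \<Rightarrow> diffop" is uminus .
lift_definition times_diffop :: "diffop \<Rightarrow> diffop \<Rightarrow> diffop" is op_comp .

instance
  by standard
    (transfer; simp add: op_comp_assoc op_comp_add_left op_comp_add_right
      op_comp_1_left op_comp_1_right)+

end

lift_definition dop_order :: "diffop \<Rightarrow> nat" is degree .

text \<open>Multiplication by a rational function, as an operator of order zero.\<close>
definition dop_of_ratfun :: "ratfun \<Rightarrow> diffop" where
  "dop_of_ratfun f = Diffop [:f:]"

lemma symbol_dop_of_ratfun: "symbol (dop_of_ratfun f) = [:f:]"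
  by (simp add: dop_of_ratfun_def Diffop_inverse)

lift_definition dop_D :: diffop (\<open>\<partial>\<close>) is "[:0, 1:]" .

text \<open>Every operator is the sum of its coefficients times powers of $\partial$.\<close>
lemma diffop_expand:
  "E = (\<Sum>i\<le>dop_order E. dop_of_ratfun (coeff (symbol E) i) * \<partial> ^ i)"
proof -
  have D_pow: "symbol (\<partial> ^ i) = monom 1 i" for i
  proof (induction i)
    case (Suc i)
    have "map_poly ratfun_deriv (monom 1 i) = 0"
      by (rule poly_eqI) (simp add: coeff_map_poly coeff_monom)
    then show ?case
      using Suc by (simp add: times_diffop.rep_eq dop_D.rep_eq op_comp_def D_comp_def monom_Suc)
  qed (simp add: one_diffop.rep_eq monom_0)
  have "symbol (\<Sum>i\<in>A. F i) = (\<Sum>i\<in>A. symbol (F i))" for A :: "nat set" and F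
    by (induction A rule: infinite_finite_induct)
      (simp_all add: zero_diffop.rep_eq plus_diffop.rep_eq)
  then show ?thesis
    by (simp add: symbol_inject[symmetric] times_diffop.rep_eq symbol_dop_of_ratfun D_pow
        op_comp_def smult_monom dop_order.rep_eq poly_as_sum_of_monoms)
qed

lemma dop_D_commute:
  "\<partial> * dop_of_ratfun f = dop_of_ratfun f * \<partial> + dop_of_ratfun (ratfun_deriv f)"
  by (simp add: symbol_inject[symmetric] symbol_dop_of_ratfun times_diffop.rep_eq
      plus_diffop.rep_eq dop_D.rep_eq op_comp_def D_comp_def map_poly_pCons)

definition dop_const :: "complex \<Rightarrow> diffop" where
  "dop_const c = dop_of_ratfun (Fract [:c:] 1)"

definition dop_x :: diffop where
  "dop_x = dop_of_ratfun (Fract [:0, 1:] 1)"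

definition dop_theta :: diffop (\<open>\<theta>\<close>) where
  "\<theta> = dop_x * \<partial>"

definition dop_reducible :: "diffop \<Rightarrow> bool" where
  "dop_reducible E \<longleftrightarrow>
    (\<exists>F1 F2. dop_order F1 > 0 \<and> dop_order F2 > 0 \<and> E = F1 * F2)"


section \<open>The operators $E_6$ and $S\!E_6$\<close>

text \<open>Parameter tuples $(e_1,\dots,e_9)$ are functions on the naturals, of which only the values
  at $1,\dots,9$ are used.\<close>

definition E6 :: "(nat \<Rightarrow> complex) \<Rightarrow> diffop" where
  "E6 e = (let
      s = (6 - (\<Sum>i = 1..9. e i)) / 3;
      s11 = e 1 + e 2 + e 3;
      s12 = e 4 + e 5 + e 6;
      s13 = e 7 + e 8 + e 9;
      s21 = e 1 * e 2 + e 1 * e 3 + e 2 * e 3;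
      s22 = e 4 * e 5 + e 4 * e 6 + e 5 * e 6;
      s23 = e 7 * e 8 + e 7 * e 9 + e 8 * e 9;
      s31 = e 1 * e 2 * e 3;
      s32 = e 4 * e 5 * e 6;
      s33 = e 7 * e 8 * e 9;
      T13 = - 3;
      T23 = 3;
      T12 = - 9 + s11 - 2 * s13;
      T22 = 18 + s13 - 2 * s11;
      T11 = - 8 + (s11^2 + 2 * s11 * s13 - s12^2 + s13^2) / 3
            + s11 - 5 * s13 - s21 + s22 - 2 * s23;
      T21 = 35 + (- (s11^2) - 2 * s11 * s13 + s12^2 - s13^2) / 3
            - 7 * s11 + 5 * s13 + 2 * s21 - s22 + s23;
      T10 = ((2 * s11 + s11^2 + 2 * s11 * s13 - s12^2 + s13^2 - s11 * s21 + 2 * s11 * s23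
              + s12 * s22 - 2 * s13 * s21 + 2 * s13 * s22 + s13 * s23 - 14 * s13) / 3
             + 2 * (s11^2 * s13 - s12^2 * s13) / 9
             + 2 * (s11^3 - s12^3) / 27
             - 5 - s21 + s31 + s22 - s32 - 5 * s23 - 3 * s33) / 2;
      T20 = - T10 + 19
            + (s11^2 * s13 - s11 * s12^2 + s11 * s13^2 - s12^2 * s13) / 9
            + (s13^3 + s11^3 - 2 * s12^3) / 27
            + (- 2 * s11^2 - 4 * s11 * s13 + s11 * s22 + 2 * s12^2 + s22 * s12
               - 2 * s13^2 + s22 * s13) / 3
            - 5 * s11 + 4 * s13 + 3 * s21 - 2 * s22 - s31 - s32 - s33;
      th = (\<lambda>c. \<theta> + dop_const c);
      B1 = dop_const T13 * \<theta>^3 + dop_const T12 * \<theta>^2 + dop_const T11 * \<theta> + dop_const T10;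
      B2 = dop_const T23 * \<theta>^3 + dop_const T22 * \<theta>^2 + dop_const T21 * \<theta> + dop_const T20;
      T0 = th (s + 2) * th (s + 1) * th s * th (e 7) * th (e 8) * th (e 9);
      T1 = th (s + 2) * th (s + 1) * B1;
      T2 = th (s + 2) * B2;
      T3 = - (th (3 - e 1) * th (3 - e 2) * th (3 - e 3))
    in T0 + T1 * \<partial> + T2 * \<partial>^2 + T3 * \<partial>^3)"

definition SE6_exps ::
  "complex \<Rightarrow> complex \<Rightarrow> complex \<Rightarrow> complex \<Rightarrow> complex \<Rightarrow> complex \<Rightarrow> complex \<Rightarrow> nat \<Rightarrow> complex" where
  "SE6_exps a b c g p q r i = (let \<delta> = a + b + c in
     [p + r + 1,
      a + c + p + r + 2,
      2 * a + 2 * c + g + p + r + 3,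
      q + r + 1,
      b + c + q + r + 2,
      2 * b + 2 * c + g + q + r + 3,
      - 2 * c - (p + q + r) - 1,
      - \<delta> - c - (p + q + r + g) - 2,
      - 2 * \<delta> - (p + q + r + g) - 3] ! (i - 1))"

definition SE6 ::
  "complex \<Rightarrow> complex \<Rightarrow> complex \<Rightarrow> complex \<Rightarrow> complex \<Rightarrow> complex \<Rightarrow> complex \<Rightarrow> diffop" where
  "SE6 a b c g p q r = E6 (SE6_exps a b c g p q r)"

end

theory Submission
  imports Defs
begin

text \<open>If \<open>E' B = A E\<close> with \<open>E\<close>, \<open>E'\<close> of equal order and \<open>B \<noteq> 0\<close> of smaller order, then \<open>B\<close> induces a
  nonzero map between the cyclic modules of \<open>E'\<close> and \<open>E\<close>, which have the same dimension over
  \<open>\<complex>(x)\<close>; so \<open>E\<close> is reducible iff \<open>E'\<close> is. The operator \<open>SE6\<close> is the additive convolution with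
  exponent \<open>r\<close> of the third order Dotsenko-Fateev operator twisted by \<open>x\<^sup>p (x - 1)\<^sup>q\<close>, and
  convolution turns intertwining relations and factorizations in the Weyl algebra into such relations
  for \<open>SE6\<close>. Explicit intertwiners show that reducibility is unchanged when \<open>c\<close>, \<open>p\<close>, \<open>q\<close> or \<open>r\<close> changes
  by an integer and (away from degenerate values) when \<open>g\<close> changes by an even integer. This leaves
  the cases \<open>c = 0\<close>, \<open>g = 1\<close>, \<open>g = - 1\<close> and the vanishing of \<open>r\<close>, of an exponent at infinity or
  of \<open>e\<^sub>i - r - 1\<close>, in which a factor is visible. Reversing the exponents at one of the three singular
  points reparametrizes \<open>SE6\<close> and carries the condition on \<open>c\<close> to the other conditions on \<open>a\<close>, \<open>b\<close>,
  \<open>c\<close>, \<open>g\<close>.\<close>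

section \<open>Right division in the ring of differential operators\<close>

lemma D_comp_pow_lead:
  assumes "Q \<noteq> 0"
  shows "degree ((D_comp ^^ i) Q) = degree Q + i"
    and "lead_coeff ((D_comp ^^ i) Q) = lead_coeff Q"
proof -
  have step: "degree (D_comp P) = Suc (degree P) \<and> lead_coeff (D_comp P) = lead_coeff P"
    if "P \<noteq> 0" for P
  proof -
    have *: "degree (map_poly ratfun_deriv P) < degree (pCons 0 P)"
      using that by (simp add: less_Suc_eq_le degree_le coeff_map_poly coeff_eq_0)
    have "degree (D_comp P) = Suc (degree P)"
      unfolding D_comp_def using that by (subst degree_add_eq_left[OF *]) simp
    moreover have "coeff (D_comp P) (Suc (degree P)) = lead_coeff P"
      by (simp add: D_comp_def coeff_map_poly coeff_eq_0)
    ultimately show ?thesis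
      by simp
  qed
  have "degree ((D_comp ^^ i) Q) = degree Q + i \<and> lead_coeff ((D_comp ^^ i) Q) = lead_coeff Q"
  proof (induction i)
    case (Suc i)
    then have "(D_comp ^^ i) Q \<noteq> 0"
      using assms by (metis leading_coeff_0_iff)
    with step Suc show ?case
      by (metis add_Suc_right comp_apply funpow.simps(2))
  qed simp
  then show "degree ((D_comp ^^ i) Q) = degree Q + i"
    and "lead_coeff ((D_comp ^^ i) Q) = lead_coeff Q"
    by auto
qed

lemma degree_op_comp_le: "degree (op_comp P Q) \<le> degree P + degree Q"
proof (cases "Q = 0")
  case False
  show ?thesis
    unfolding op_comp_def
    by (intro degree_sum_le order.trans[OF degree_smult_le]) (auto simp: D_comp_pow_lead[OF False])
qed (simp add: op_comp_def)

lemma coeff_op_comp_top: "coeff (op_comp P Q) (degree P + degree Q) = lead_coeff P * lead_coeff Q"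
proof (cases "Q = 0")
  case False
  have "coeff (op_comp P Q) (degree P + degree Q)
      = (\<Sum>i\<le>degree P. coeff P i * coeff ((D_comp ^^ i) Q) (degree P + degree Q))"
    by (simp add: op_comp_def coeff_sum)
  also have "\<dots> = (\<Sum>i\<in>{degree P}. coeff P i * coeff ((D_comp ^^ i) Q) (degree P + degree Q))"
    by (intro sum.mono_neutral_right) (auto simp: D_comp_pow_lead[OF False] intro!: coeff_eq_0)
  also have "\<dots> = lead_coeff P * lead_coeff Q"
    using D_comp_pow_lead[OF False, of "degree P"] by (simp add: add.commute)
  finally show ?thesis .
qed (simp add: op_comp_def)

definition dop_lead :: "diffop \<Rightarrow> ratfun" where
  "dop_lead F = lead_coeff (symbol F)"

lemma symbol_eq_0_iff [simp]: "symbol F = 0 \<longleftrightarrow> F = 0"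
  by (metis symbol_inject zero_diffop.rep_eq)

lemma dop_lead_eq_0_iff [simp]: "dop_lead F = 0 \<longleftrightarrow> F = 0"
  by (simp add: dop_lead_def)

lemma coeff_symbol_mult_top:
  "coeff (symbol (F * G)) (dop_order F + dop_order G) = dop_lead F * dop_lead G"
  by (simp add: times_diffop.rep_eq dop_order.rep_eq dop_lead_def coeff_op_comp_top)

instance diffop :: ring_1_no_zero_divisors
proof
  fix F G :: diffop
  assume "F \<noteq> 0" "G \<noteq> 0"
  then have "coeff (symbol (F * G)) (dop_order F + dop_order G) \<noteq> 0"
    by (simp add: coeff_symbol_mult_top)
  then show "F * G \<noteq> 0"
    by (auto simp: zero_diffop.rep_eq)
qed

lemma dop_order_mult_le: "dop_order (F * G) \<le> dop_order F + dop_order G"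
  by (simp add: times_diffop.rep_eq dop_order.rep_eq degree_op_comp_le)

lemma dop_order_mult:
  assumes "F \<noteq> 0" "G \<noteq> 0"
  shows "dop_order (F * G) = dop_order F + dop_order G"
proof (rule antisym[OF dop_order_mult_le])
  have "coeff (symbol (F * G)) (dop_order F + dop_order G) \<noteq> 0"
    using assms by (simp add: coeff_symbol_mult_top)
  then show "dop_order F + dop_order G \<le> dop_order (F * G)"
    by (simp add: dop_order.rep_eq le_degree)
qed

lemma dop_order_diff_le: "max (dop_order F) (dop_order G) \<le> n \<Longrightarrow> dop_order (F - G) \<le> n"
  by (simp add: dop_order.rep_eq minus_diffop.rep_eq degree_diff_le)

lemma dop_order_add_le: "max (dop_order F) (dop_order G) \<le> n \<Longrightarrow> dop_order (F + G) \<le> n"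
  by (simp add: dop_order.rep_eq plus_diffop.rep_eq degree_add_le)

lemma dop_order_0 [simp]: "dop_order 0 = 0"
  and dop_order_1 [simp]: "dop_order 1 = 0"
  by (simp_all add: dop_order.rep_eq zero_diffop.rep_eq one_diffop.rep_eq)

lemma symbol_dop_D_power: "symbol (\<partial> ^ i) = monom 1 i"
proof (induction i)
  case (Suc i)
  have "map_poly ratfun_deriv (monom 1 i) = 0"
    by (rule poly_eqI) (simp add: coeff_map_poly coeff_monom)
  then show ?case
    using Suc by (simp add: times_diffop.rep_eq dop_D.rep_eq op_comp_def D_comp_def monom_Suc)
qed (simp add: one_diffop.rep_eq monom_0)

lemma dop_division:
  assumes "G \<noteq> 0"
  obtains Q V where "U = Q * G + V" "V = 0 \<or> dop_order V < dop_order G"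
proof -
  have "\<exists>Q V. U = Q * G + V \<and> (V = 0 \<or> dop_order V < dop_order G)"
  proof (induction "dop_order U" arbitrary: U rule: less_induct)
    case less
    show ?case
    proof (cases "U = 0 \<or> dop_order U < dop_order G")
      case True
      then show ?thesis
        by (intro exI[of _ 0] exI[of _ U]) auto
    next
      case False
      \<comment> \<open>Composition multiplies leading coefficients, as differentiating coefficients
        only produces terms of lower order; so \<open>Q0 * G\<close> cancels the top term of
        \<open>U\<close>.\<close>
      define Q0 where "Q0 = dop_of_ratfun (dop_lead U / dop_lead G) * \<partial> ^ (dop_order U - dop_order G)"
      have sym: "symbol Q0 = monom (dop_lead U / dop_lead G) (dop_order U - dop_order G)"
        by (simp add: Q0_def times_diffop.rep_eq symbol_dop_of_ratfun symbol_dop_D_power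
            op_comp_def smult_monom)
      have "dop_lead U / dop_lead G \<noteq> 0"
        using False assms by simp
      then have ord: "dop_order Q0 + dop_order G = dop_order U"
        and lead: "dop_lead Q0 = dop_lead U / dop_lead G"
        using False by (simp_all add: dop_order.rep_eq sym degree_monom_eq dop_lead_def)
      define U' where "U' = U - Q0 * G"
      have "coeff (symbol U') (dop_order U) = 0"
        using coeff_symbol_mult_top[of Q0 G] assms unfolding ord lead
        by (simp add: U'_def minus_diffop.rep_eq dop_lead_def dop_order.rep_eq)
      moreover have "dop_order U' \<le> dop_order U"
        unfolding U'_def using dop_order_mult_le[of Q0 G] ord by (intro dop_order_diff_le) simp
      ultimately have "U' = 0 \<or> dop_order U' < dop_order U"
        by (metis dop_order.rep_eq le_neq_implies_less leading_coeff_0_iff symbol_eq_0_iff)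
      then have "\<exists>Q V. U' = Q * G + V \<and> (V = 0 \<or> dop_order V < dop_order G)"
        using less by (metis add.right_neutral mult_zero_left)
      then obtain Q V where QV: "U' = Q * G + V" "V = 0 \<or> dop_order V < dop_order G"
        by blast
      then have "U = (Q0 + Q) * G + V"
        by (simp add: U'_def algebra_simps diff_eq_eq)
      with QV show ?thesis
        by blast
    qed
  qed
  with that show ?thesis
    by blast
qed

lemma dop_unit:
  assumes "F \<noteq> 0" "dop_order F = 0"
  obtains F' where "F' * F = 1"
proof -
  obtain f where f: "symbol F = [:f:]"
    using assms(2) by (auto simp: dop_order.rep_eq elim: degree_eq_zeroE)
  with assms(1) have "f \<noteq> 0"
    by (metis pCons_0_0 symbol_eq_0_iff)
  then have "dop_of_ratfun (inverse f) * F = 1"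
    by (simp add: symbol_inject[symmetric] times_diffop.rep_eq symbol_dop_of_ratfun f
        op_comp_def one_diffop.rep_eq one_pCons)
  then show ?thesis
    by (rule that)
qed

text \<open>The Ore condition with an order bound, by the Euclidean algorithm: after
  \<open>U = Q * G + V\<close>, a common left multiple of \<open>G\<close> and \<open>V\<close>
  yields one of \<open>U\<close> and \<open>G\<close>.\<close>

lemma common_left_multiple:
  assumes "G \<noteq> 0"
  obtains P S where "P \<noteq> 0" "dop_order P \<le> dop_order G" "P * U = S * G"
proof -
  have "\<exists>P S. P \<noteq> 0 \<and> dop_order P \<le> dop_order G \<and> P * U = S * G"
    using assms
  proof (induction "dop_order G" arbitrary: G U rule: less_induct)
    case less
    obtain Q V where QV: "U = Q * G + V" "V = 0 \<or> dop_order V < dop_order G"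
      using dop_division[OF less.prems] .
    show ?case
    proof (cases "V = 0")
      case True
      with QV show ?thesis
        by (intro exI[of _ 1] exI[of _ Q]) simp
    next
      case False
      then obtain P S where PS: "P \<noteq> 0" "dop_order P \<le> dop_order V" "P * G = S * V"
        using less.hyps[of V G] QV by blast
      then have "S \<noteq> 0"
        using less.prems by auto
      have "dop_order S + dop_order V = dop_order P + dop_order G"
        using PS False less.prems \<open>S \<noteq> 0\<close> dop_order_mult by metis
      then have "dop_order S \<le> dop_order G"
        using PS(2) by linarith
      moreover have "S * U = (S * Q + P) * G"
        by (simp add: QV(1) PS(3) algebra_simps)
      ultimately show ?thesis
        using \<open>S \<noteq> 0\<close> by blast
    qed
  qed
  with that show ?thesis
    by blast
qed

text \<open>Left ideals are principal: division by a nonzero element of least order leaves no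
  remainder.\<close>

lemma dop_gcrd:
  fixes B E :: diffop
  assumes "E \<noteq> 0"
  obtains K B' E' X Y where "B = B' * K" "E = E' * K" "K = X * B + Y * E"
proof -
  define J where "J = {X * B + Y * E | X Y. True}"
  have "E = 0 * B + 1 * E" "B = 1 * B + 0 * E"
    by simp_all
  then have E: "E \<in> J" and B: "B \<in> J"
    unfolding J_def by blast+
  obtain K where K: "K \<in> J" "K \<noteq> 0" and min: "\<And>P. P \<in> J \<Longrightarrow> P \<noteq> 0 \<Longrightarrow> dop_order K \<le> dop_order P"
    by (metis (no_types, lifting) E assms ex_has_least_nat[of "\<lambda>K. K \<in> J \<and> K \<noteq> 0" E dop_order])
  have dvd: "\<exists>Q. P = Q * K" if P: "P \<in> J" for P
  proof -
    obtain Q V where QV: "P = Q * K + V" "V = 0 \<or> dop_order V < dop_order K"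
      using dop_division[OF K(2)] .
    obtain X Y X' Y' where "P = X * B + Y * E" "K = X' * B + Y' * E"
      using P K(1) unfolding J_def by blast
    then have "V = (X - Q * X') * B + (Y - Q * Y') * E"
      using QV(1) by (simp add: algebra_simps)
    then have "V \<in> J"
      unfolding J_def by blast
    with QV min show ?thesis
      by (metis add.right_neutral leD)
  qed
  obtain X Y where "K = X * B + Y * E"
    using K(1) unfolding J_def by blast
  with dvd[OF B] dvd[OF E] that show ?thesis
    by blast
qed

section \<open>Transfer of reducibility along intertwining operators\<close>

lemma irreducible_bezout:
  assumes irr: "\<not> dop_reducible E" and E: "E \<noteq> 0" and B: "\<nexists>S. B = S * E"
  obtains X Y where "X * B + Y * E = 1"
proof -
  obtain K B' E' X Y where K: "B = B' * K" "E = E' * K" "K = X * B + Y * E"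
    using dop_gcrd[OF E] .
  have nz: "K \<noteq> 0" "E' \<noteq> 0"
    using K(2) E by auto
  have "dop_order E' = 0 \<or> dop_order K = 0"
    using irr K(2) unfolding dop_reducible_def by (metis gr0I)
  moreover have "dop_order E' \<noteq> 0"
  proof
    assume "dop_order E' = 0"
    then obtain F where "F * E' = 1"
      using dop_unit nz by blast
    then have "B = (B' * F) * E"
      by (metis K(1,2) mult.assoc mult.left_neutral)
    with B show False by blast
  qed
  ultimately obtain F where "F * K = 1"
    using dop_unit nz by blast
  then have "(F * X) * B + (F * Y) * E = 1"
    using K(3) by (simp add: algebra_simps)
  then show ?thesis
    by (rule that)
qed

text \<open>The left module generated by \<open>B\<close> modulo a simple \<open>E\<close> has the same dimension as that of \<open>E\<close>,
  so \<open>B\<close> cannot be annihilated by an operator of smaller order.\<close>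

lemma irreducible_annihilator:
  assumes irr: "\<not> dop_reducible E" and E: "E \<noteq> 0"
    and F: "F \<noteq> 0" "dop_order F < dop_order E" and FB: "F * B = A * E"
  shows "\<exists>S. B = S * E"
proof (rule ccontr)
  assume "\<not> ?thesis"
  then obtain X Y where XY: "X * B + Y * E = 1"
    using irreducible_bezout[OF irr E] by blast
  obtain P S where P: "P \<noteq> 0" "dop_order P \<le> dop_order F" "P * X = S * F"
    using common_left_multiple[OF F(1)] .
  have "P = P * (X * B + Y * E)"
    by (simp add: XY)
  also have "\<dots> = (S * A + P * Y) * E"
    using P(3) FB by (simp add: distrib_left distrib_right flip: mult.assoc) (simp add: mult.assoc)
  finally have PE: "P = (S * A + P * Y) * E" .
  with P(1) have "S * A + P * Y \<noteq> 0" by auto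
  with PE E have "dop_order E \<le> dop_order P"
    by (metis dop_order_mult le_add2)
  with P(2) F(2) show False
    by simp
qed

text \<open>In a factorization \<open>E' = F1 * F2\<close> both factors have order below that of
  \<open>E\<close>. As \<open>F1\<close> annihilates \<open>F2 * B\<close> modulo \<open>E\<close>,
  \<open>irreducible_annihilator\<close> makes \<open>F2 * B\<close> vanish modulo \<open>E\<close>;
  applied again with \<open>F2\<close>, it makes \<open>B\<close> vanish.\<close>

lemma irreducible_transfer:
  assumes irr: "\<not> dop_reducible E" and ord: "dop_order E' = dop_order E" and E': "E' \<noteq> 0"
    and int: "E' * B = A * E" and B: "\<nexists>S. B = S * E" and E: "E \<noteq> 0"
  shows "\<not> dop_reducible E'"
proof
  assume "dop_reducible E'"
  then obtain F1 F2 where F: "E' = F1 * F2" "dop_order F1 > 0" "dop_order F2 > 0"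
    unfolding dop_reducible_def by blast
  have nz: "F1 \<noteq> 0" "F2 \<noteq> 0"
    using F(1) E' by auto
  have sum: "dop_order E = dop_order F1 + dop_order F2"
    using dop_order_mult[OF nz] F(1) ord by simp
  have "F1 * (F2 * B) = A * E"
    using int F(1) by (simp add: mult.assoc)
  then obtain S where "F2 * B = S * E"
    using irreducible_annihilator[OF irr E nz(1)] F sum by fastforce
  then show False
    using irreducible_annihilator[OF irr E nz(2)] F sum B by fastforce
qed

proposition reducible_transfer:
  assumes ord: "dop_order E' = dop_order E" and int: "E' * B = A * E"
    and B: "B \<noteq> 0" "dop_order B < dop_order E"
  shows "dop_reducible E \<longleftrightarrow> dop_reducible E'"
proof -
  have E: "E \<noteq> 0" "E' \<noteq> 0"
    using ord B(2) by auto
  have BE: "\<nexists>S. B = S * E"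
  proof
    assume "\<exists>S. B = S * E"
    then obtain S where S: "B = S * E" ..
    with B(1) have "S \<noteq> 0" by auto
    then show False
      using dop_order_mult[of S E] E B(2) S by simp
  qed
  have "\<not> dop_reducible E" if irr: "\<not> dop_reducible E'"
  proof -
    \<comment> \<open>The annihilator of \<open>B\<close> modulo \<open>E\<close> is a proper left
      ideal containing \<open>E'\<close>, hence generated by the irreducible
      \<open>E'\<close>.\<close>
    have kernel: "\<exists>S. P = S * E'" if P: "P * B = R * E" for P R
    proof (rule ccontr)
      assume "\<not> ?thesis"
      then obtain X Y where XY: "X * P + Y * E' = 1"
        using irreducible_bezout[OF irr E(2)] by blast
      have "B = (X * P + Y * E') * B"
        by (simp add: XY)
      also have "\<dots> = (X * R + Y * A) * E"
        by (simp add: distrib_right mult.assoc P int)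
      finally show False
        using BE by blast
    qed
    obtain K B' E1 X Y where K: "B = B' * K" "E = E1 * K" "K = X * B + Y * E"
      using dop_gcrd[OF E(1)] .
    have nz: "K \<noteq> 0" "E1 \<noteq> 0"
      using K(2) E by auto
    \<comment> \<open>Some nonzero \<open>P\<close> of order at most that of \<open>E1\<close> kills
      \<open>B\<close> modulo \<open>E\<close>; being a multiple of \<open>E'\<close>, it forces the
      common right factor \<open>K\<close> to have order 0.\<close>
    obtain P S where P: "P \<noteq> 0" "dop_order P \<le> dop_order E1" "P * B' = S * E1"
      using common_left_multiple[OF nz(2)] .
    have "P * B = S * E"
      using K P(3) by (metis mult.assoc)
    then obtain S' where S': "P = S' * E'"
      using kernel by blast
    with P(1) have "S' \<noteq> 0" by auto
    with S' E have "dop_order E' \<le> dop_order P"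
      by (simp add: dop_order_mult)
    then have "dop_order K = 0"
      using P(2) ord K(2) dop_order_mult[OF nz(2,1)] by simp
    then obtain F where "F * K = 1"
      using dop_unit nz by blast
    then have XY: "(F * X) * B + (F * Y) * E = 1"
      using K(3) by (metis distrib_left mult.assoc)
    \<comment> \<open>\<open>\<alpha>\<close> inverts \<open>B\<close> modulo \<open>E\<close>, so
      it intertwines in the opposite direction and \<open>irreducible_transfer\<close> applies with
      the roles exchanged.\<close>
    define \<alpha> where "\<alpha> = F * X"
    have \<alpha>B: "\<alpha> * B = 1 - (F * Y) * E"
      using XY by (simp add: \<alpha>_def eq_diff_eq)
    have "(E * \<alpha>) * B = (1 - E * (F * Y)) * E"
      by (simp add: mult.assoc \<alpha>B) (simp add: algebra_simps)
    then obtain A' where A': "E * \<alpha> = A' * E'"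
      using kernel by blast
    have "\<nexists>S. \<alpha> = S * E'"
    proof
      assume "\<exists>S. \<alpha> = S * E'"
      then obtain S where "\<alpha> = S * E'" ..
      then have "1 = (S * A + F * Y) * E"
        using XY int by (simp add: \<alpha>_def distrib_right mult.assoc)
      then have "B = (B * (S * A + F * Y)) * E"
        by (metis mult.assoc mult.right_neutral)
      with BE show False by blast
    qed
    then show ?thesis
      using irreducible_transfer[OF irr ord[symmetric] E(1) A' _ E(2)] by blast
  qed
  moreover have "\<not> dop_reducible E'" if "\<not> dop_reducible E"
    using irreducible_transfer[OF that ord E(2) int BE E(1)] .
  ultimately show ?thesis
    by blast
qed

section \<open>Polynomials in the Euler operator\<close>

lemma dop_of_ratfun_add: "dop_of_ratfun (f + g) = dop_of_ratfun f + dop_of_ratfun g"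
  and dop_of_ratfun_mult: "dop_of_ratfun (f * g) = dop_of_ratfun f * dop_of_ratfun g"
  and dop_of_ratfun_1: "dop_of_ratfun 1 = 1"
  and dop_of_ratfun_0: "dop_of_ratfun 0 = 0"
  by (simp_all add: symbol_inject[symmetric] symbol_dop_of_ratfun plus_diffop.rep_eq
      times_diffop.rep_eq one_diffop.rep_eq zero_diffop.rep_eq op_comp_def one_pCons)

lemma dop_const_add: "dop_const (a + b) = dop_const a + dop_const b"
  and dop_const_mult: "dop_const (a * b) = dop_const a * dop_const b"
  and dop_const_0 [simp]: "dop_const 0 = 0"
  and dop_const_1 [simp]: "dop_const 1 = 1"
proof -
  show "dop_const (a + b) = dop_const a + dop_const b"
    unfolding dop_const_def dop_of_ratfun_add[symmetric] by simp
  show "dop_const (a * b) = dop_const a * dop_const b"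
    unfolding dop_const_def dop_of_ratfun_mult[symmetric] by (simp add: mult.commute)
  have "Fract [:0::complex:] 1 = 0" "Fract [:1::complex:] 1 = 1"
    by (simp_all add: Zero_fract_def One_fract_def one_pCons)
  then show "dop_const 0 = 0" "dop_const 1 = 1"
    by (simp_all only: dop_const_def dop_of_ratfun_1 dop_of_ratfun_0)
qed

lemma dop_const_commute_D: "\<partial> * dop_const a = dop_const a * \<partial>"
  unfolding dop_const_def dop_D_commute
  by (simp add: ratfun_deriv_Fract fract_collapse dop_of_ratfun_0 pderiv_pCons)

lemma dop_const_commute_theta: "\<theta> * dop_const a = dop_const a * \<theta>"
proof -
  have "dop_x * dop_const a = dop_const a * dop_x"
    unfolding dop_const_def dop_x_def dop_of_ratfun_mult[symmetric] by (simp add: mult.commute)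
  then show ?thesis
    unfolding dop_theta_def by (metis dop_const_commute_D mult.assoc)
qed

lemma dop_D_theta: "\<partial> * \<theta> = (\<theta> + 1) * \<partial>"
proof -
  have "\<partial> * dop_x = dop_x * \<partial> + 1"
    unfolding dop_x_def dop_D_commute
    by (simp add: ratfun_deriv_Fract fract_collapse dop_of_ratfun_1 pderiv_pCons flip: one_pCons)
  then show ?thesis
    unfolding dop_theta_def by (metis mult.assoc distrib_right mult_1)
qed

definition theta_poly :: "complex poly \<Rightarrow> diffop" where
  "theta_poly f = fold_coeffs (\<lambda>a F. dop_const a + \<theta> * F) f 0"

lemma theta_poly_0 [simp]: "theta_poly 0 = 0"
  by (simp add: theta_poly_def)

lemma theta_poly_pCons [simp]: "theta_poly (pCons a f) = dop_const a + \<theta> * theta_poly f"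
  by (cases "f = 0"; cases "a = 0") (simp_all add: theta_poly_def)

lemma theta_poly_add: "theta_poly (f + g) = theta_poly f + theta_poly g"
  by (induction f g rule: poly_induct2) (simp_all add: dop_const_add algebra_simps)

lemma theta_poly_uminus: "theta_poly (- f) = - theta_poly f"
  using theta_poly_add[of f "- f"] by (simp add: eq_neg_iff_add_eq_0 add.commute)

lemma theta_poly_sum: "theta_poly (\<Sum>i\<in>I. f i) = (\<Sum>i\<in>I. theta_poly (f i))"
  by (induction I rule: infinite_finite_induct) (simp_all add: theta_poly_add)

lemma theta_poly_smult: "theta_poly (smult a f) = dop_const a * theta_poly f"
  by (induction f)
    (simp_all add: dop_const_mult distrib_left mult.assoc[symmetric] dop_const_commute_theta)

lemma theta_poly_mult: "theta_poly (f * g) = theta_poly f * theta_poly g"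
  by (induction f) (simp_all add: theta_poly_add theta_poly_smult algebra_simps)

lemma theta_poly_1 [simp]: "theta_poly 1 = 1"
  by (simp add: one_pCons)

lemma theta_poly_power: "theta_poly (f ^ n) = theta_poly f ^ n"
  by (induction n) (simp_all add: theta_poly_mult)

lemma dop_D_theta_poly: "\<partial> * theta_poly f = theta_poly (pcompose f [:1, 1:]) * \<partial>"
proof (induction f)
  case (pCons a f)
  have "\<partial> * theta_poly (pCons a f) = dop_const a * \<partial> + (\<theta> + 1) * (\<partial> * theta_poly f)"
    by (simp add: distrib_left dop_const_commute_D flip: mult.assoc dop_D_theta)
  also have "\<dots> = (dop_const a + (\<theta> + 1) * theta_poly (pcompose f [:1, 1:])) * \<partial>"
    by (simp add: pCons.IH algebra_simps)
  finally show ?case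
    by (simp add: pcompose_pCons theta_poly_add theta_poly_mult algebra_simps)
qed simp

lemma dop_D_power_theta_poly:
  "\<partial> ^ i * theta_poly f = theta_poly (pcompose f [:of_nat i, 1:]) * \<partial> ^ i"
proof (induction i)
  case (Suc i)
  have "\<partial> ^ Suc i * theta_poly f = \<partial> * (\<partial> ^ i * theta_poly f)"
    by (simp add: mult.assoc)
  also have "\<dots> = theta_poly (pcompose (pcompose f [:of_nat i, 1:]) [:1, 1:]) * \<partial> ^ Suc i"
    by (simp add: Suc dop_D_theta_poly flip: mult.assoc)
  also have "pcompose (pcompose f [:of_nat i, 1:]) [:1, 1:] = pcompose f [:of_nat (Suc i), 1:]"
    by (simp add: pcompose_pCons add.commute flip: pcompose_assoc)
  finally show ?case .
qed simp

text \<open>Upper bounds on the orders suffice: if one of them is strict, both sides are 0.\<close>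

lemma coeff_symbol_mult_bound:
  assumes "dop_order F \<le> m" "dop_order G \<le> n"
  shows "coeff (symbol (F * G)) (m + n) = coeff (symbol F) m * coeff (symbol G) n"
proof (cases "dop_order F = m \<and> dop_order G = n")
  case True
  then show ?thesis
    using coeff_symbol_mult_top[of F G] by (auto simp: dop_lead_def dop_order.rep_eq)
next
  case False
  with assms have *: "dop_order F < m \<or> dop_order G < n" "dop_order F + dop_order G < m + n"
    by auto
  have "dop_order (F * G) < m + n"
    using dop_order_mult_le[of F G] * by linarith
  with * show ?thesis
    by (auto simp: dop_order.rep_eq coeff_eq_0)
qed

section \<open>Leading terms of polynomials in the Euler operator\<close>

lemma symbol_dop_const: "symbol (dop_const a) = [:Fract [:a:] 1:]"
  by (simp add: dop_const_def symbol_dop_of_ratfun)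

lemma symbol_dop_theta: "symbol \<theta> = [:0, Fract [:0, 1:] 1:]"
  by (simp add: dop_theta_def dop_x_def times_diffop.rep_eq symbol_dop_of_ratfun
      op_comp_def dop_D.rep_eq)

lemma dop_order_simps [simp]: "dop_order (dop_const a) = 0" "dop_order \<theta> = 1"
  "dop_order (\<partial> ^ i) = i"
  by (simp_all add: dop_order.rep_eq symbol_dop_const symbol_dop_theta symbol_dop_D_power
      degree_monom_eq fract_expand eq_fract)

lemma dop_order_theta_poly_le: "dop_order (theta_poly f) \<le> degree f"
proof (induction f)
  case (pCons a f)
  show ?case
  proof (cases "f = 0")
    case False
    have "dop_order (\<theta> * theta_poly f) \<le> degree (pCons a f)"
      using dop_order_mult_le[of \<theta> "theta_poly f"] pCons.IH False by simp
    then show ?thesis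
      by (simp add: dop_order_add_le)
  qed simp
qed simp

text \<open>\<open>\<theta> ^ d\<close> is \<open>x ^ d * \<partial> ^ d\<close> plus terms of lower
  order.\<close>

lemma coeff_symbol_theta_poly:
  "degree f \<le> d \<Longrightarrow> coeff (symbol (theta_poly f)) d = Fract (monom (coeff f d) d) 1"
proof (induction f arbitrary: d)
  case (pCons a f)
  show ?case
  proof (cases d)
    case 0
    with pCons.prems have "f = 0"
      by (auto split: if_splits)
    then show ?thesis
      by (simp add: 0 symbol_dop_const monom_0)
  next
    case (Suc d')
    have deg: "degree f \<le> d'"
      using pCons.prems Suc by (simp split: if_splits)
    have "coeff (symbol (\<theta> * theta_poly f)) (1 + d')
        = coeff (symbol \<theta>) 1 * coeff (symbol (theta_poly f)) d'"
      using deg dop_order_theta_poly_le[of f] by (intro coeff_symbol_mult_bound) auto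
    then show ?thesis
      using Suc pCons.IH[OF deg]
      by (simp add: plus_diffop.rep_eq symbol_dop_const symbol_dop_theta coeff_pCons monom_Suc)
  qed
qed (simp add: zero_diffop.rep_eq fract_collapse)

section \<open>Additive convolution\<close>

text \<open>For \<open>M = (\<Sum>i\<le>n. x\<^sup>n\<^sup>-\<^sup>i T\<^sub>i(\<theta>))\<close> the operator \<open>conv_op r n T\<close> is
  \<open>\<partial>\<^sup>n \<circ> M\<close> conjugated by \<open>\<partial>\<^sup>r\<^sup>+\<^sup>1\<close>, i.e. with \<open>\<theta>\<close> replaced by \<open>\<theta> - r - 1\<close>: it annihilates
  the Riemann-Liouville transforms \<open>\<integral> (x - t)\<^sup>r f(t) dt\<close> of the solutions \<open>f\<close> of \<open>M\<close>.\<close>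

definition conv_coeff :: "complex \<Rightarrow> nat \<Rightarrow> nat \<Rightarrow> complex poly \<Rightarrow> complex poly" where
  "conv_coeff r n i f = (\<Prod>k=i..<n. [:of_nat k - r, 1:]) * pcompose f [:of_nat i - 1 - r, 1:]"

definition conv_op :: "complex \<Rightarrow> nat \<Rightarrow> (nat \<Rightarrow> complex poly) \<Rightarrow> diffop" where
  "conv_op r n T = (\<Sum>i\<le>n. theta_poly (conv_coeff r n i (T i)) * \<partial> ^ i)"

text \<open>The coefficients of the product of \<open>\<Sum>i\<le>n. x\<^sup>n\<^sup>-\<^sup>i S\<^sub>i(\<theta>)\<close> and \<open>\<Sum>j\<le>m. x\<^sup>m\<^sup>-\<^sup>j T\<^sub>j(\<theta>)\<close>.\<close>

definition conv_prod :: "nat \<Rightarrow> nat \<Rightarrow> (nat \<Rightarrow> complex poly) \<Rightarrow> (nat \<Rightarrow> complex poly) \<Rightarrow> nat \<Rightarrow> complex poly"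
  where "conv_prod n m S T k =
    (\<Sum>i\<le>n. \<Sum>j\<le>m. if i + j = k then pcompose (S i) [:of_nat (m - j), 1:] * T j else 0)"

lemma conv_coeff_sum: "conv_coeff r n i (\<Sum>j\<in>J. f j) = (\<Sum>j\<in>J. conv_coeff r n i (f j))"
  by (simp add: conv_coeff_def pcompose_sum sum_distrib_left)

lemma conv_coeff_0 [simp]: "conv_coeff r n i 0 = 0"
  by (simp add: conv_coeff_def)

lemma conv_op_cong: "(\<And>i. i \<le> n \<Longrightarrow> S i = T i) \<Longrightarrow> conv_op r n S = conv_op r n T"
  by (simp add: conv_op_def)

lemma conv_coeff_mult:
  assumes "i \<le> n" "j \<le> m"
  shows "conv_coeff (r - of_nat m) n i f * pcompose (conv_coeff r m j g) [:of_nat i, 1:]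
    = conv_coeff r (n + m) (i + j) (pcompose f [:of_nat (m - j), 1:] * g)"
proof -
  have "poly (conv_coeff (r - of_nat m) n i f * pcompose (conv_coeff r m j g) [:of_nat i, 1:]) w
    = poly (conv_coeff r (n + m) (i + j) (pcompose f [:of_nat (m - j), 1:] * g)) w" for w
  proof -
    \<comment> \<open>The range \<open>i..<n\<close> moved by \<open>m\<close> and the range
      \<open>j..<m\<close> moved by \<open>i\<close> are adjacent and cover
      \<open>i + j..<n + m\<close>.\<close>
    have shift: "(\<Prod>k=i+j..<i+m. of_nat k - r + w) = (\<Prod>k=j..<m. of_nat k - r + (of_nat i + w))"
      "(\<Prod>k=i+m..<n+m. of_nat k - r + w) = (\<Prod>k=i..<n. of_nat k - (r - of_nat m) + w)"
      using prod.shift_bounds_nat_ivl[of "\<lambda>k. of_nat k - r + w" j i m]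
        prod.shift_bounds_nat_ivl[of "\<lambda>k. of_nat k - r + w" i m n]
      by (simp_all add: algebra_simps)
    have "(\<Prod>k=i+j..<n+m. of_nat k - r + w)
        = (\<Prod>k=i+j..<i+m. of_nat k - r + w) * (\<Prod>k=i+m..<n+m. of_nat k - r + w)"
      using assms by (simp add: prod.atLeastLessThan_concat)
    also have "\<dots> = (\<Prod>k=j..<m. of_nat k - r + (of_nat i + w)) * (\<Prod>k=i..<n. of_nat k - (r - of_nat m) + w)"
      by (simp only: shift)
    finally show ?thesis
      using assms by (simp add: conv_coeff_def poly_pcompose poly_prod of_nat_diff algebra_simps)
  qed
  then show ?thesis
    by (subst poly_eq_poly_eq_iff[symmetric]) blast
qed

text \<open>Lowering the parameter of the left factor by \<open>m\<close> absorbs the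
  \<open>\<partial> ^ m\<close> in the right factor, so the product of the unconvolved operators is
  convolved as a whole.\<close>

lemma conv_op_mult:
  "conv_op (r - of_nat m) n S * conv_op r m T = conv_op r (n + m) (conv_prod n m S T)"
proof -
  have "conv_op (r - of_nat m) n S * conv_op r m T
      = (\<Sum>i\<le>n. \<Sum>j\<le>m. theta_poly (conv_coeff (r - of_nat m) n i (S i)) * \<partial> ^ i *
          (theta_poly (conv_coeff r m j (T j)) * \<partial> ^ j))"
    by (simp add: conv_op_def sum_product)
  also have "\<dots> = (\<Sum>i\<le>n. \<Sum>j\<le>m. theta_poly (conv_coeff r (n + m) (i + j)
      (pcompose (S i) [:of_nat (m - j), 1:] * T j)) * \<partial> ^ (i + j))"
  proof (intro sum.cong refl)
    fix i j assume "i \<in> {..n}" "j \<in> {..m}"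
    have "theta_poly (conv_coeff (r - of_nat m) n i (S i)) * \<partial> ^ i *
          (theta_poly (conv_coeff r m j (T j)) * \<partial> ^ j)
        = theta_poly (conv_coeff (r - of_nat m) n i (S i)) *
          (\<partial> ^ i * theta_poly (conv_coeff r m j (T j))) * \<partial> ^ j"
      by (simp only: mult.assoc)
    also have "\<dots> = theta_poly (conv_coeff (r - of_nat m) n i (S i) *
        pcompose (conv_coeff r m j (T j)) [:of_nat i, 1:]) * \<partial> ^ (i + j)"
      by (simp only: dop_D_power_theta_poly theta_poly_mult power_add mult.assoc)
    finally show "theta_poly (conv_coeff (r - of_nat m) n i (S i)) * \<partial> ^ i *
          (theta_poly (conv_coeff r m j (T j)) * \<partial> ^ j)
        = theta_poly (conv_coeff r (n + m) (i + j)
            (pcompose (S i) [:of_nat (m - j), 1:] * T j)) * \<partial> ^ (i + j)"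
      using \<open>i \<in> {..n}\<close> \<open>j \<in> {..m}\<close> by (simp add: conv_coeff_mult)
  qed
  also have "\<dots> = (\<Sum>i\<le>n. \<Sum>j\<le>m. \<Sum>k\<le>n + m. if i + j = k then theta_poly (conv_coeff r (n + m) k
      (pcompose (S i) [:of_nat (m - j), 1:] * T j)) * \<partial> ^ k else 0)"
    by (intro sum.cong refl) (simp add: sum.delta)
  also have "\<dots> = (\<Sum>k\<le>n + m. \<Sum>i\<le>n. \<Sum>j\<le>m. if i + j = k then theta_poly (conv_coeff r (n + m) k
      (pcompose (S i) [:of_nat (m - j), 1:] * T j)) * \<partial> ^ k else 0)"
    by (subst sum.swap[of _ "{..n + m}"]) (intro sum.cong refl sum.swap)
  also have "\<dots> = conv_op r (n + m) (conv_prod n m S T)"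
    unfolding conv_op_def conv_prod_def
    by (simp only: conv_coeff_sum theta_poly_sum sum_distrib_right, intro sum.cong refl) simp
  finally show ?thesis .
qed

section \<open>Orders of convolved operators\<close>

lemma degree_conv_coeff:
  assumes "i \<le> n" "degree f \<le> d"
  shows "degree (conv_coeff r n i f) \<le> n - i + d"
    and "coeff (conv_coeff r n i f) (n - i + d) = coeff f d"
proof -
  let ?P = "\<Prod>k=i..<n. [:of_nat k - r, 1:]" and ?c = "[:of_nat i - 1 - r, 1:]"
  have P: "degree ?P = n - i" "lead_coeff ?P = 1"
    by (simp add: degree_prod_sum_eq, subst lead_coeff_prod) simp
  have "degree (pcompose f ?c) \<le> d"
    using assms(2) by (simp add: degree_pcompose)
  then show "degree (conv_coeff r n i f) \<le> n - i + d"
    unfolding conv_coeff_def using degree_mult_le[of ?P "pcompose f ?c"] P(1) by linarith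
  have "coeff (pcompose f ?c) d = coeff f d"
  proof (cases "degree f = d")
    case True
    then show ?thesis
      using lead_coeff_comp[of ?c f] by (simp add: degree_pcompose)
  next
    case False
    with assms(2) show ?thesis
      by (simp add: coeff_eq_0 degree_pcompose)
  qed
  moreover have "coeff (?P * pcompose f ?c) (n - i + d) = coeff ?P (n - i) * coeff (pcompose f ?c) d"
    using P(1) \<open>degree (pcompose f ?c) \<le> d\<close>
    by (cases "degree (pcompose f ?c) = d")
      (use coeff_mult_degree_sum[of ?P "pcompose f ?c"] degree_mult_le[of ?P "pcompose f ?c"] in
        \<open>auto simp: coeff_eq_0\<close>)
  ultimately show "coeff (conv_coeff r n i f) (n - i + d) = coeff f d"
    using P by (simp add: conv_coeff_def)
qed

lemma dop_order_conv_op_le: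
  assumes "\<And>i. i \<le> n \<Longrightarrow> degree (T i) \<le> d"
  shows "dop_order (conv_op r n T) \<le> n + d"
    and "coeff (symbol (conv_op r n T)) (n + d)
      = Fract (\<Sum>i\<le>n. monom (coeff (T i) d) (n - i + d)) 1"
proof -
  have ord: "dop_order (theta_poly (conv_coeff r n i (T i))) \<le> n - i + d" if "i \<le> n" for i
    using degree_conv_coeff(1)[OF that assms[OF that]] dop_order_theta_poly_le
    by (rule order.trans[rotated])
  have sym_sum: "symbol (\<Sum>i\<in>A. F i) = (\<Sum>i\<in>A. symbol (F i))" for A :: "nat set" and F
    by (induction A rule: infinite_finite_induct)
      (simp_all add: zero_diffop.rep_eq plus_diffop.rep_eq)
  show "dop_order (conv_op r n T) \<le> n + d"
    unfolding conv_op_def dop_order.rep_eq sym_sum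
  proof (rule degree_sum_le)
    fix i assume "i \<in> {..n}"
    then show "degree (symbol (theta_poly (conv_coeff r n i (T i)) * \<partial> ^ i)) \<le> n + d"
      using dop_order_mult_le[of "theta_poly (conv_coeff r n i (T i))" "\<partial> ^ i"] ord[of i]
      by (simp add: dop_order.rep_eq[symmetric])
  qed simp
  have Fract_sum: "(\<Sum>i\<in>A. Fract (p i) 1) = Fract (\<Sum>i\<in>A. p i) 1" for A :: "nat set" and p :: "nat \<Rightarrow> complex poly"
    by (induction A rule: infinite_finite_induct) (simp_all add: Zero_fract_def)
  have "coeff (symbol (theta_poly (conv_coeff r n i (T i)) * \<partial> ^ i)) (n + d)
      = Fract (monom (coeff (T i) d) (n - i + d)) 1" if "i \<le> n" for i
  proof -
    have "n + d = (n - i + d) + i"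
      using that by simp
    then have "coeff (symbol (theta_poly (conv_coeff r n i (T i)) * \<partial> ^ i)) (n + d)
      = coeff (symbol (theta_poly (conv_coeff r n i (T i)))) (n - i + d) * coeff (symbol (\<partial> ^ i)) i"
      using ord[OF that] by (metis coeff_symbol_mult_bound dop_order_simps(3) order_refl)
    also have "\<dots> = Fract (monom (coeff (T i) d) (n - i + d)) 1"
      using degree_conv_coeff[OF that assms[OF that]]
      by (simp add: coeff_symbol_theta_poly symbol_dop_D_power)
    finally show ?thesis .
  qed
  then show "coeff (symbol (conv_op r n T)) (n + d)
      = Fract (\<Sum>i\<le>n. monom (coeff (T i) d) (n - i + d)) 1"
    by (simp add: conv_op_def sym_sum coeff_sum Fract_sum)
qed

text \<open>To the coefficient of \<open>\<partial> ^ (n + d)\<close> the term \<open>i\<close>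
  contributes a multiple of \<open>x ^ (n - i + d)\<close>. These powers are distinct, so nothing
  cancels.\<close>

lemma conv_op_top_nonzero:
  assumes "\<And>i. i \<le> n \<Longrightarrow> degree (T i) \<le> d" and i: "i \<le> n" "coeff (T i) d \<noteq> 0"
  shows "conv_op r n T \<noteq> 0" and "dop_order (conv_op r n T) = n + d"
proof -
  let ?p = "\<Sum>j\<le>n. monom (coeff (T j) d) (n - j + d)"
  have "coeff ?p (n - i + d) = (\<Sum>j\<le>n. if j = i then coeff (T j) d else 0)"
    unfolding coeff_sum using i by (intro sum.cong refl) auto
  also have "\<dots> = coeff (T i) d"
    using i by simp
  finally have "?p \<noteq> 0"
    using i(2) by auto
  then have *: "coeff (symbol (conv_op r n T)) (n + d) \<noteq> 0"
    using dop_order_conv_op_le(2)[of n T d r] assms(1) by (simp add: fract_expand eq_fract)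
  then show "conv_op r n T \<noteq> 0"
    by (auto simp: zero_diffop.rep_eq)
  have "n + d \<le> dop_order (conv_op r n T)"
    using * by (simp add: dop_order.rep_eq le_degree)
  moreover have "dop_order (conv_op r n T) \<le> n + d"
    using assms(1) by (rule dop_order_conv_op_le)
  ultimately show "dop_order (conv_op r n T) = n + d"
    by simp
qed

lemma conv_op_nonzero:
  assumes "i \<le> n" "T i \<noteq> 0"
  shows "conv_op r n T \<noteq> 0"
proof -
  define d where "d = Max ((\<lambda>i. degree (T i)) ` {i. i \<le> n \<and> T i \<noteq> 0})"
  have fin: "finite ((\<lambda>i. degree (T i)) ` {i. i \<le> n \<and> T i \<noteq> 0})"
    by simp
  have "d \<in> (\<lambda>i. degree (T i)) ` {i. i \<le> n \<and> T i \<noteq> 0}"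
    unfolding d_def using assms by (intro Max_in fin) auto
  then obtain j where j: "j \<le> n" "T j \<noteq> 0" "d = degree (T j)"
    by auto
  have "degree (T i) \<le> d" if "i \<le> n" for i
    unfolding d_def using that by (cases "T i = 0") (auto intro!: Max_ge)
  then show ?thesis
    using j by (intro conv_op_top_nonzero(1)[of n T d j]) auto
qed

lemma poly_conv_prod:
  "poly (conv_prod n m S T k) y
    = (\<Sum>i\<le>n. \<Sum>j\<le>m. if i + j = k then poly (S i) (y + of_nat (m - j)) * poly (T j) y else 0)"
  unfolding conv_prod_def poly_sum
  by (intro sum.cong refl) (simp add: poly_pcompose add.commute)

text \<open>Comparing values at \<open>y\<close> reduces intertwining to identities between complex
  numbers.\<close>

lemma conv_op_intertwining:
  assumes "\<And>y. \<forall>k\<le>n + m. poly (conv_prod n m S' T k) y = poly (conv_prod m n T' S k) y"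
  shows "conv_op (r - of_nat m) n S' * conv_op r m T = conv_op (r - of_nat n) m T' * conv_op r n S"
  unfolding conv_op_mult add.commute[of m n]
  by (rule conv_op_cong) (use assms in \<open>simp add: poly_eq_poly_eq_iff[symmetric] fun_eq_iff\<close>)

lemma conv_op_factor:
  assumes "\<And>y. \<forall>k\<le>n + m. poly (conv_prod n m S T k) y = poly (M k) y"
  shows "conv_op r (n + m) M = conv_op (r - of_nat m) n S * conv_op r m T"
  unfolding conv_op_mult
  by (rule conv_op_cong) (use assms in \<open>simp add: poly_eq_poly_eq_iff[symmetric] fun_eq_iff\<close>)

text \<open>As orders are subadditive, the two upper bounds already make both orders
  positive.\<close>

lemma reducible_if_small_factors:
  assumes "E = F1 * F2" "dop_order F1 < dop_order E" "dop_order F2 < dop_order E"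
  shows "dop_reducible E"
proof -
  have "dop_order E \<le> dop_order F1 + dop_order F2"
    using assms(1) dop_order_mult_le by simp
  with assms show ?thesis
    unfolding dop_reducible_def by (intro exI[of _ F1] exI[of _ F2]) simp
qed

section \<open>The Dotsenko-Fateev operator\<close>

text \<open>With \<open>N = x(x - 1)\<partial> - p(x - 1) - qx = x u - v\<close>, where \<open>u = \<theta> - p - q\<close> and \<open>v = \<theta> - p\<close>, these are
  the coefficients of \<open>N + k\<^sub>0 + k\<^sub>1 x\<close> and of
  \<open>l N\<^sup>2 + (b\<^sub>0 + b\<^sub>1 x) N + c\<^sub>0 + c\<^sub>1 x + c\<^sub>2 x\<^sup>2\<close> at the descending powers of \<open>x\<close>.\<close>

definition lin_poly :: "complex \<Rightarrow> complex \<Rightarrow> complex \<Rightarrow> complex \<Rightarrow> nat \<Rightarrow> complex poly" where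
  "lin_poly k0 k1 p q i = (let u = [:- p - q, 1:]; v = [:- p, 1:] in [u + [:k1:], - v + [:k0:]] ! i)"

definition quad_poly ::
  "complex \<Rightarrow> complex \<Rightarrow> complex \<Rightarrow> complex \<Rightarrow> complex \<Rightarrow> complex \<Rightarrow> complex \<Rightarrow> complex \<Rightarrow> nat \<Rightarrow> complex poly"
  where "quad_poly l b0 b1 c0 c1 c2 p q i = (let u = [:- p - q, 1:]; v = [:- p, 1:] in
    [smult l (u * (u + 1)) + smult b1 u + [:c2:],
     - smult l ((2 * v + 1) * u) + smult b0 u - smult b1 v + [:c1:],
     smult l (v * v) - smult b0 v + [:c0:]] ! i)"

text \<open>The Dotsenko-Fateev operator, with solutions multiplied by \<open>x\<^sup>p (x - 1)\<^sup>q\<close>, is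
  \<open>N\<^sup>3 + (\<alpha>20 + \<alpha>21 x) N\<^sup>2 + (\<alpha>10 + \<alpha>11 x + \<alpha>12 x\<^sup>2) N + x (x - 1) (\<alpha>01 + \<alpha>02 x)\<close>; its exponents
  are \<open>p + {0, A, 2 A + g}\<close> at \<open>0\<close> and \<open>q + {0, B, 2 B + g}\<close> at \<open>1\<close>, and \<open>- p - q - {l1, l2, l3}\<close> are those at
  infinity (as powers of \<open>1 / x\<close>).\<close>

definition SE3_coeff :: "'a::comm_ring_1 \<Rightarrow> 'a \<Rightarrow> 'a \<Rightarrow> 'a \<Rightarrow> 'a \<Rightarrow> 'a \<Rightarrow> nat \<Rightarrow> 'a" where
  "SE3_coeff a b c g u v i = (let
      A = a + c + 1; B = b + c + 1;
      l1 = 2 * c; l2 = a + b + 2 * c + g + 1; l3 = 2 * (a + b + c) + g + 2;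
      \<alpha>20 = 3 * A + g; \<alpha>21 = - (3 * A + g) - (3 * B + g);
      \<alpha>10 = A * (2 * A + g); \<alpha>12 = l1 * l2 + l1 * l3 + l2 * l3 - 2 - \<alpha>21;
      \<alpha>11 = B * (2 * B + g) - \<alpha>10 - \<alpha>12;
      \<alpha>02 = - l1 * l2 * l3; \<alpha>01 = c * (2 * A + g - 1) * l3
    in
     [(u - l1) * (u - l2) * (u - l3),
      - (v + 2) * (u + 1) * u - (u + 1) * (2 * u * v + u) + \<alpha>20 * (u + 1) * u
        - \<alpha>21 * (2 * u * v + u) + \<alpha>11 * u - \<alpha>12 * v + \<alpha>01 - \<alpha>02,
      (v + 1) * (2 * u * v + u) + u * v * v - \<alpha>20 * (2 * u * v + u) + \<alpha>21 * v * v
        + \<alpha>10 * u - \<alpha>11 * v - \<alpha>01,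
      - v * (v - A) * (v - 2 * A - g)] ! i)"

text \<open>\<open>SE3_coeff\<close> is generic in the ring, so that one formula serves for
  polynomials in \<theta> here and for their values in \<open>poly_SE3_poly\<close>.\<close>

definition SE3_poly ::
  "complex \<Rightarrow> complex \<Rightarrow> complex \<Rightarrow> complex \<Rightarrow> complex \<Rightarrow> complex \<Rightarrow> nat \<Rightarrow> complex poly" where
  "SE3_poly a b c g p q = SE3_coeff [:a:] [:b:] [:c:] [:g:] [:- p - q, 1:] [:- p, 1:]"

lemma le_numeral_cases:
  "k \<le> 2 \<Longrightarrow> k = 0 \<or> k = 1 \<or> k = (2::nat)"
  "k \<le> 3 \<Longrightarrow> k = 0 \<or> k = 1 \<or> k = 2 \<or> k = (3::nat)"
  "k \<le> 4 \<Longrightarrow> k = 0 \<or> k = 1 \<or> k = 2 \<or> k = 3 \<or> k = (4::nat)"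
  "k \<le> 5 \<Longrightarrow> k = 0 \<or> k = 1 \<or> k = 2 \<or> k = 3 \<or> k = 4 \<or> k = (5::nat)"
  by linarith+

lemma all_le_numeral:
  "(\<forall>k\<le>3. P k) \<longleftrightarrow> P 0 \<and> P 1 \<and> P 2 \<and> P (3::nat)"
  "(\<forall>k\<le>4. P k) \<longleftrightarrow> P 0 \<and> P 1 \<and> P 2 \<and> P 3 \<and> P (4::nat)"
  "(\<forall>k\<le>5. P k) \<longleftrightarrow> P 0 \<and> P 1 \<and> P 2 \<and> P 3 \<and> P 4 \<and> P (5::nat)"
  by (auto dest!: le_numeral_cases)

lemma poly_SE3_poly: "i \<le> 3 \<Longrightarrow> poly (SE3_poly a b c g p q i) y = SE3_coeff a b c g (y - p - q) (y - p) i"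
  by (drule le_numeral_cases(2), elim disjE)
    (simp_all add: SE3_poly_def SE3_coeff_def Let_def algebra_simps)

lemma degree_SE3_poly: "i \<le> 3 \<Longrightarrow> degree (SE3_poly a b c g p q i) \<le> 3"
  by (drule le_numeral_cases(2), elim disjE)
    (simp_all add: SE3_poly_def SE3_coeff_def Let_def numeral_poly one_pCons degree_pCons_eq_if)

lemma coeff_SE3_poly_0: "coeff (SE3_poly a b c g p q 0) 3 = 1"
  by (simp add: SE3_poly_def SE3_coeff_def Let_def numeral_poly one_pCons numeral_3_eq_3)

lemma degree_quad_poly: "i \<le> 2 \<Longrightarrow> degree (quad_poly l b0 b1 c0 c1 c2 p q i) \<le> 2"
  by (drule le_numeral_cases(1), elim disjE)
    (simp_all add: quad_poly_def Let_def numeral_poly one_pCons degree_pCons_eq_if)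

lemma quad_poly_nonzero: "l \<noteq> 0 \<or> b0 \<noteq> 0 \<Longrightarrow> quad_poly l b0 b1 c0 c1 c2 p q 2 \<noteq> 0"
  by (auto simp: quad_poly_def Let_def)

lemma degree_lin_poly: "i \<le> 1 \<Longrightarrow> degree (lin_poly k0 k1 p q i) \<le> 1"
  by (cases i) (simp_all add: lin_poly_def Let_def degree_pCons_eq_if)

lemma dop_order_SE3_conv: "dop_order (conv_op r 3 (SE3_poly a b c g p q)) = 6"
  using conv_op_top_nonzero(2)[of 3 "SE3_poly a b c g p q" 3 0 r]
  by (simp add: degree_SE3_poly coeff_SE3_poly_0)

text \<open>The intertwiner has order at most \<open>m + 2\<close>, hence at most 4, below the
  common order 6.\<close>

lemma SE3_conv_reducible_iff:
  assumes "\<And>y. \<forall>k\<le>3 + m. poly (conv_prod 3 m (SE3_poly a' b' c' g' p' q') T k) y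
      = poly (conv_prod m 3 T' (SE3_poly a b c g p q) k) y"
    and "m \<le> 2" "\<And>i. i \<le> m \<Longrightarrow> degree (T i) \<le> 2" "j \<le> m" "T j \<noteq> 0" "r' = r - of_nat m"
  shows "dop_reducible (conv_op r 3 (SE3_poly a b c g p q))
    \<longleftrightarrow> dop_reducible (conv_op r' 3 (SE3_poly a' b' c' g' p' q'))"
proof (rule reducible_transfer)
  show "conv_op r' 3 (SE3_poly a' b' c' g' p' q') * conv_op r m T
      = conv_op (r - of_nat 3) m T' * conv_op r 3 (SE3_poly a b c g p q)"
    unfolding assms(6) by (rule conv_op_intertwining) (rule assms(1))
  show "conv_op r m T \<noteq> 0"
    using assms(4,5) by (rule conv_op_nonzero)
  have "dop_order (conv_op r m T) \<le> m + 2"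
    using assms(3) by (rule dop_order_conv_op_le)
  then show "dop_order (conv_op r m T) < dop_order (conv_op r 3 (SE3_poly a b c g p q))"
    using assms(2) by (simp add: dop_order_SE3_conv)
qed (simp add: dop_order_SE3_conv)

lemmas conv_prod_expand = poly_conv_prod atMost_nat_numeral pred_numeral_simps
  poly_SE3_poly SE3_coeff_def quad_poly_def lin_poly_def Let_def

section \<open>Contiguity\<close>

text \<open>The intertwiners for \<open>c\<close> and \<open>g\<close> are determined, up to a factor, within the ansatz
  \<open>l N\<^sup>2 + (b\<^sub>0 + b\<^sub>1 x) N + c\<^sub>0 + c\<^sub>1 x + c\<^sub>2 x\<^sup>2\<close> by their effect on the exponents: for \<open>c\<close> they add
  \<open>(2, 1, 0)\<close> at \<open>0\<close> and at \<open>1\<close> and \<open>(- 2, - 2, - 2)\<close> at infinity, for \<open>g\<close> they add \<open>(0, 0, 2)\<close>,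
  \<open>(0, 0, 2)\<close> and \<open>(0, - 2, - 2)\<close>. The one for \<open>g\<close> can vanish identically, hence the hypotheses of
  \<open>reducible_shift_g\<close>. Those for \<open>p\<close>, \<open>q\<close>, \<open>r\<close> are \<open>x\<close>, \<open>x - 1\<close> and \<open>1\<close>.\<close>

lemma reducible_shift_c:
  "dop_reducible (conv_op r 3 (SE3_poly a b c g p q))
    \<longleftrightarrow> dop_reducible (conv_op (r - 2) 3 (SE3_poly a b (c - 1) g (p + 2) (q + 2)))"
proof (rule SE3_conv_reducible_iff[where j = 2])
  let ?k = "c * (2 * (a + b + c) + g + 2)" and ?k' = "c * (2 * (a + b + c) + g) - a - b"
  show "\<forall>k\<le>3 + 2. poly (conv_prod 3 2 (SE3_poly a b (c - 1) g (p + 2) (q + 2))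
      (quad_poly 1 (a + c + 1) (- (a + b + 2 * c + 2)) 0 (- ?k) ?k p q) k) y
    = poly (conv_prod 2 3 (quad_poly 1 (a + c) (- (a + b + 2 * c)) 0 (- ?k') ?k' (p + 2) (q + 2))
      (SE3_poly a b c g p q) k) y" for y
    by (simp add: all_le_numeral, intro conjI; (simp add: conv_prod_expand, algebra?))
qed (simp_all add: degree_quad_poly quad_poly_nonzero)

lemma reducible_shift_g:
  assumes "g \<noteq> - 1" "2 * b + g + 2 \<noteq> 0"
  shows "dop_reducible (conv_op r 3 (SE3_poly a b c g p q))
    \<longleftrightarrow> dop_reducible (conv_op (r - 2) 3 (SE3_poly a b c (g + 2) p q))"
proof (rule SE3_conv_reducible_iff[where j = 2])
  let ?A = "a + c + 1" and ?B = "b + c + 1" and ?D = "2 * (a + b + c) + 3 * g + 6"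
    and ?n0 = "- (g + 1) * (2 * b + g + 2)" and ?n1 = "- (g + 1) * (2 * a + g + 2)"
  let ?w = "- (?D * (2 * (a + b + c) + g + 2) + (g + 1) * (2 * c + g + 2))"
  let ?e = "(2 * c + 1) * (3 * ?D - ?w)"
  let ?T = "quad_poly ?D (?n0 + (2 * ?A + g) * ?D) (?w - (2 * c + 1) * ?D)
      ((2 * ?A + g) * ?n0) ((2 * ?B + g) * ?n1 - (2 * ?A + g) * ?n0 + 2 * c * ?w) (- 2 * c * ?w) p q"
    and ?T' = "quad_poly ?D (?n0 + (2 * ?A + g + 2) * ?D) (?w - (2 * c + 5) * ?D)
      ((2 * ?A + g + 2) * ?n0) ((2 * ?B + g + 2) * ?n1 - (2 * ?A + g + 2) * ?n0 - ?e) ?e p q"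
  show "\<forall>k\<le>3 + 2. poly (conv_prod 3 2 (SE3_poly a b c (g + 2) p q) ?T k) y
    = poly (conv_prod 2 3 ?T' (SE3_poly a b c g p q) k) y" for y
    by (simp add: all_le_numeral, intro conjI; (simp add: conv_prod_expand, (((rule disjI2)+)?, algebra)?))
  \<comment> \<open>If \<open>?D\<close> vanishes, the coefficient \<open>b0\<close> reduces to
    \<open>?n0\<close>, which the hypotheses keep nonzero.\<close>
  show "?T 2 \<noteq> 0"
  proof -
    have "- (g + 1) \<noteq> 0"
      using assms(1) by (simp only: neg_equal_0_iff_equal eq_neg_iff_add_eq_0) simp
    then show ?thesis
      using assms(2) by (intro quad_poly_nonzero) auto
  qed
qed (simp_all add: degree_quad_poly)

lemma reducible_shift_r:
  "dop_reducible (conv_op r 3 (SE3_poly a b c g p q))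
    \<longleftrightarrow> dop_reducible (conv_op (r - 1) 3 (SE3_poly a b c g p q))"
proof (rule SE3_conv_reducible_iff[where j = 1])
  \<comment> \<open>The operator 1, written with \<open>m = 1\<close>; its convolution is
    \<partial>.\<close>
  let ?T = "\<lambda>i. if i = 0 then 0 else 1 :: complex poly"
  show "\<forall>k\<le>3 + 1. poly (conv_prod 3 1 (SE3_poly a b c g p q) ?T k) y
    = poly (conv_prod 1 3 ?T (SE3_poly a b c g p q) k) y" for y
    by (simp add: all_le_numeral, intro conjI; (simp add: conv_prod_expand, (((rule disjI2)+)?, algebra)?))
qed simp_all

lemma reducible_shift_p:
  "dop_reducible (conv_op r 3 (SE3_poly a b c g p q))
    \<longleftrightarrow> dop_reducible (conv_op (r - 1) 3 (SE3_poly a b c g (p + 1) q))"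
proof (rule SE3_conv_reducible_iff[where j = 0])
  \<comment> \<open>The operator \<open>x\<close>; its convolution is
    \<open>\<theta> - r\<close>.\<close>
  let ?T = "\<lambda>i. if i = 0 then 1 else 0 :: complex poly"
  show "\<forall>k\<le>3 + 1. poly (conv_prod 3 1 (SE3_poly a b c g (p + 1) q) ?T k) y
    = poly (conv_prod 1 3 ?T (SE3_poly a b c g p q) k) y" for y
    by (simp add: all_le_numeral, intro conjI; (simp add: conv_prod_expand, (((rule disjI2)+)?, algebra)?))
qed simp_all

lemma reducible_shift_q:
  "dop_reducible (conv_op r 3 (SE3_poly a b c g p q))
    \<longleftrightarrow> dop_reducible (conv_op (r - 1) 3 (SE3_poly a b c g p (q + 1)))"
proof (rule SE3_conv_reducible_iff[where j = 0])
  let ?T = "\<lambda>i. if i = 0 then 1 else - 1 :: complex poly"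
  show "\<forall>k\<le>3 + 1. poly (conv_prod 3 1 (SE3_poly a b c g p (q + 1)) ?T k) y
    = poly (conv_prod 1 3 ?T (SE3_poly a b c g p q) k) y" for y
    by (simp add: all_le_numeral, intro conjI; (simp add: conv_prod_expand, (((rule disjI2)+)?, algebra)?))
qed simp_all

section \<open>Visible factors\<close>

text \<open>The left factor has order at most \<open>n + 2\<close>, hence at most 5. The bound
  \<open>d\<close> on the right is separate because splitting off \<open>x - 1\<close> leaves a
  cofactor of degree 3.\<close>

lemma SE3_conv_reducible_if_factor:
  assumes "\<And>y. \<forall>k\<le>3. poly (conv_prod n m S T k) y = poly (SE3_poly a b c g p q k) y"
    and "n + m = 3" "\<And>i. i \<le> n \<Longrightarrow> degree (S i) \<le> 2" "\<And>i. i \<le> m \<Longrightarrow> degree (T i) \<le> d"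
    and "m + d < 6"
  shows "dop_reducible (conv_op r 3 (SE3_poly a b c g p q))"
proof (rule reducible_if_small_factors)
  have "conv_op r (n + m) (SE3_poly a b c g p q) = conv_op (r - of_nat m) n S * conv_op r m T"
    by (rule conv_op_factor) (use assms in simp)
  then show "conv_op r 3 (SE3_poly a b c g p q) = conv_op (r - of_nat m) n S * conv_op r m T"
    by (simp only: assms(2))
  have "dop_order (conv_op (r - of_nat m) n S) \<le> n + 2"
    using assms(3) by (rule dop_order_conv_op_le)
  then show "dop_order (conv_op (r - of_nat m) n S) < dop_order (conv_op r 3 (SE3_poly a b c g p q))"
    using assms(2) by (simp add: dop_order_SE3_conv)
  have "dop_order (conv_op r m T) \<le> m + d"
    using assms(4) by (rule dop_order_conv_op_le)
  then show "dop_order (conv_op r m T) < dop_order (conv_op r 3 (SE3_poly a b c g p q))"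
    using assms(5) by (simp add: dop_order_SE3_conv)
qed

text \<open>For \<open>c = 0\<close> the coefficients \<open>\<alpha>01\<close> and
  \<open>\<alpha>02\<close> vanish, so \<open>N\<close>, which is \<open>lin_poly 0 0\<close>,
  splits off on the right.\<close>

lemma reducible_c_0: "dop_reducible (conv_op r 3 (SE3_poly a b 0 g p q))"
proof (rule SE3_conv_reducible_if_factor[where d = 1])
  let ?A = "a + 1" and ?B = "b + 1"
  let ?a21 = "- (3 * ?A + g) - (3 * ?B + g)" and ?a10 = "?A * (2 * ?A + g)"
  let ?a12 = "(a + b + g + 1) * (2 * (a + b) + g + 2) - 2 - ?a21"
  show "\<forall>k\<le>3. poly (conv_prod 2 1
      (quad_poly 1 (3 * ?A + g) ?a21 ?a10 (?B * (2 * ?B + g) - ?a10 - ?a12) ?a12 p q)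
      (lin_poly 0 0 p q) k) y = poly (SE3_poly a b 0 g p q k) y" for y
    by (simp add: all_le_numeral, intro conjI; (simp add: conv_prod_expand, (((rule disjI2)+)?, algebra)?))
qed (use degree_lin_poly in \<open>simp_all add: degree_quad_poly\<close>)

text \<open>For \<open>g = 1\<close> the function \<open>x\<^sup>A (x - 1)\<^sup>B\<close> is a solution of the Dotsenko-Fateev equation: the double
  integral with \<open>(t\<^sub>1 - t\<^sub>2)\<^sup>g\<close> is a Wronskian. The case \<open>g = - 1\<close> is dual to it.\<close>

lemma reducible_g_1: "dop_reducible (conv_op r 3 (SE3_poly a b c 1 p q))"
proof (rule SE3_conv_reducible_if_factor[where d = 1])
  let ?A = "a + c + 1" and ?B = "b + c + 1"
    and ?l1 = "2 * c" and ?l2 = "a + b + 2 * c + 2" and ?l3 = "2 * (a + b + c) + 3"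
  let ?a20 = "3 * ?A + 1" and ?a21 = "- (3 * ?A + 1) - (3 * ?B + 1)" and ?a10 = "?A * (2 * ?A + 1)"
  let ?a12 = "?l1 * ?l2 + ?l1 * ?l3 + ?l2 * ?l3 - 2 - ?a21"
  let ?a11 = "?B * (2 * ?B + 1) - ?a10 - ?a12"
  let ?c0 = "?a20 - ?A" and ?c1 = "?a21 + ?A + ?B"
  show "\<forall>k\<le>3. poly (conv_prod 2 1
      (quad_poly 1 ?c0 ?c1 (?a10 - ?c0 * ?A) (?a11 - 2 * (?A + ?B) + ?c0 * (?A + ?B) - ?c1 * ?A)
        (?a12 + 2 * (?A + ?B) + ?c1 * (?A + ?B)) p q)
      (lin_poly ?A (- ?A - ?B) p q) k) y = poly (SE3_poly a b c 1 p q k) y" for y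
    by (simp add: all_le_numeral, intro conjI; (simp add: conv_prod_expand, (((rule disjI2)+)?, algebra)?))
qed (use degree_lin_poly in \<open>simp_all add: degree_quad_poly\<close>)

lemma reducible_g_minus_1: "dop_reducible (conv_op r 3 (SE3_poly a b c (- 1) p q))"
proof (rule SE3_conv_reducible_if_factor[where d = 2])
  let ?A = "a + c + 1" and ?B = "b + c + 1"
    and ?l1 = "2 * c" and ?l2 = "a + b + 2 * c" and ?l3 = "2 * (a + b + c) + 1"
  let ?a20 = "3 * ?A - 1" and ?a21 = "- (3 * ?A - 1) - (3 * ?B - 1)" and ?a10 = "?A * (2 * ?A - 1)"
  let ?a12 = "?l1 * ?l2 + ?l1 * ?l3 + ?l2 * ?l3 - 2 - ?a21"
  let ?a11 = "?B * (2 * ?B - 1) - ?a10 - ?a12"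
  let ?c0 = "?a20 - ?A" and ?c1 = "?a21 + ?A + ?B"
  show "\<forall>k\<le>3. poly (conv_prod 1 2 (lin_poly ?A (- ?A - ?B) p q)
      (quad_poly 1 ?c0 ?c1 (?a10 - ?c0 * ?A) (?a11 + ?c1 + ?c0 * (?A + ?B) - ?c1 * ?A)
        (?a12 - ?c1 + ?c1 * (?A + ?B)) p q) k) y = poly (SE3_poly a b c (- 1) p q k) y" for y
    by (simp add: all_le_numeral, intro conjI; (simp add: conv_prod_expand, (((rule disjI2)+)?, algebra)?))
  show "degree (lin_poly ?A (- ?A - ?B) p q i) \<le> 2" if "i \<le> 1" for i
    using degree_lin_poly[OF that] by (rule order.trans) simp
qed (simp_all add: degree_quad_poly)

text \<open>An exponent at 1 vanishes, which makes the coefficients at the powers of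
  \<open>x\<close> sum to 0. Then \<open>x - 1\<close> splits off on the left, and the cofactor has
  their partial sums as coefficients.\<close>

lemma reducible_q_exponent_0:
  assumes "q * (q + b + c + 1) * (q + 2 * b + 2 * c + g + 2) = 0"
  shows "dop_reducible (conv_op r 3 (SE3_poly a b c g p q))"
proof (rule SE3_conv_reducible_if_factor[where d = 3])
  let ?T = "\<lambda>k. \<Sum>i\<le>k. SE3_poly a b c g p q i"
  have sum: "(\<Sum>i\<le>3. SE3_coeff a b c g (y - p - q) (y - p) i) = 0" for y
  proof -
    have "(\<Sum>i\<le>3. SE3_coeff a b c g (y - p - q) (y - p) i)
        = - (q * (q + b + c + 1) * (q + 2 * b + 2 * c + g + 2))"
      by (simp add: atMost_nat_numeral pred_numeral_simps SE3_coeff_def Let_def) algebra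
    with assms show ?thesis
      by simp
  qed
  show "\<forall>k\<le>3. poly (conv_prod 1 2 (\<lambda>i. if i = 0 then 1 else - 1) ?T k) y
      = poly (SE3_poly a b c g p q k) y" for y
    using sum[of y]
    by (simp add: all_le_numeral poly_conv_prod atMost_nat_numeral pred_numeral_simps poly_SE3_poly)
      algebra
  show "degree (?T k) \<le> 3" if "k \<le> 2" for k
    using that by (intro degree_sum_le degree_SE3_poly) auto
qed simp_all

text \<open>Below the top index the factor comes from \<open>k = n\<close> in the product of
  \<open>conv_coeff\<close>; at the top index, where that product is empty, it comes from the root
  at 0.\<close>

lemma conv_op_left_factor:
  assumes "[:0, 1:] dvd T (Suc n)"
  obtains G where "conv_op r (Suc n) T = theta_poly [:of_nat n - r, 1:] * G"
proof -
  have "\<exists>f. conv_coeff r (Suc n) i (T i) = [:of_nat n - r, 1:] * f" if "i \<le> Suc n" for i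
  proof (cases "i = Suc n")
    case True
    obtain f where "T (Suc n) = [:0, 1:] * f"
      using assms by (elim dvdE)
    then have "conv_coeff r (Suc n) i (T i) = [:of_nat n - r, 1:] * pcompose f [:of_nat n - r, 1:]"
      using True by (simp add: conv_coeff_def pcompose_mult pcompose_pCons)
    then show ?thesis ..
  next
    case False
    with that have "conv_coeff r (Suc n) i (T i) = [:of_nat n - r, 1:] * conv_coeff r n i (T i)"
      by (simp add: conv_coeff_def prod.atLeastLessThan_Suc mult_ac del: mult_pCons_left mult_pCons_right)
    then show ?thesis ..
  qed
  then obtain f where f: "\<And>i. i \<le> Suc n \<Longrightarrow> conv_coeff r (Suc n) i (T i) = [:of_nat n - r, 1:] * f i"
    by metis
  have "conv_op r (Suc n) T = theta_poly [:of_nat n - r, 1:] * (\<Sum>i\<le>Suc n. theta_poly (f i) * \<partial> ^ i)"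
    unfolding conv_op_def sum_distrib_left
    by (intro sum.cong refl) (simp only: f atMost_iff theta_poly_mult mult.assoc)
  then show ?thesis
    by (rule that)
qed

text \<open>Only the term \<open>i = 0\<close> lacks a right factor \<partial>; it gains one from
  \<open>\<theta> = dop_x * \<partial>\<close>.\<close>

lemma conv_op_right_factor:
  assumes "poly (conv_coeff r n 0 (T 0)) 0 = 0"
  obtains G where "conv_op r n T = G * \<partial>"
proof -
  have "[:0, 1:] dvd conv_coeff r n 0 (T 0)"
    using assms by (simp add: poly_eq_0_iff_dvd)
  then obtain f where "conv_coeff r n 0 (T 0) = f * [:0, 1:]"
    by (metis dvdE mult.commute)
  then have "theta_poly (conv_coeff r n 0 (T 0)) = theta_poly f * dop_x * \<partial>"
    by (simp only: theta_poly_mult) (simp add: dop_theta_def mult.assoc)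
  then have "conv_op r n T = (theta_poly f * dop_x
      + (\<Sum>i<n. theta_poly (conv_coeff r n (Suc i) (T (Suc i))) * \<partial> ^ i)) * \<partial>"
    by (simp add: conv_op_def sum.atMost_shift distrib_right sum_distrib_right mult.assoc power_commutes)
  then show ?thesis
    by (rule that)
qed

lemma reducible_if_first_order_factor:
  assumes "E = F1 * F2" "dop_order E > 2" "dop_order F1 = 1 \<or> dop_order F2 = 1"
  shows "dop_reducible E"
proof (rule reducible_if_small_factors[OF assms(1)])
  have "F1 \<noteq> 0" "F2 \<noteq> 0"
    using assms(1,2) by auto
  then have sum: "dop_order E = dop_order F1 + dop_order F2"
    using assms(1) dop_order_mult by simp
  show "dop_order F1 < dop_order E" "dop_order F2 < dop_order E"
    using assms(2,3) sum by auto
qed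

section \<open>Identification of \<open>SE6\<close>\<close>

lemma theta_plus_const: "\<theta> + dop_const t = theta_poly [:t, 1:]"
  by (simp add: add.commute)

lemma theta_cubic:
  "dop_const t3 * \<theta> ^ 3 + dop_const t2 * \<theta> ^ 2 + dop_const t1 * \<theta> + dop_const t0
    = theta_poly [:t0, t1, t2, t3:]"
proof -
  have "\<theta> = theta_poly [:0, 1:]" "dop_const t0 = theta_poly [:t0:]"
    by simp_all
  then have "dop_const t3 * \<theta> ^ 3 + dop_const t2 * \<theta> ^ 2 + dop_const t1 * \<theta> + dop_const t0
    = theta_poly (smult t3 ([:0, 1:] ^ 3) + smult t2 ([:0, 1:] ^ 2) + smult t1 [:0, 1:] + [:t0:])"
    by (simp only: theta_poly_add theta_poly_smult theta_poly_power)
  also have "smult t3 ([:0, 1:] ^ 3) + smult t2 ([:0, 1:] ^ 2) + smult t1 [:0, 1:] + [:t0:]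
      = [:t0, t1, t2, t3:]"
    by (simp add: power2_eq_square power3_eq_cube)
  finally show ?thesis .
qed

lemma SE6_eq_conv_op: "SE6 a b c g p q r = conv_op r 3 (SE3_poly a b c g p q)"
proof -
  define e where "e = SE6_exps a b c g p q r"
  note exps = e_def SE6_exps_def Let_def
  have e: "e 1 = p + r + 1" "e 2 = a + c + p + r + 2" "e 3 = 2 * a + 2 * c + g + p + r + 3"
    "e 4 = q + r + 1" "e 5 = b + c + q + r + 2" "e 6 = 2 * b + 2 * c + g + q + r + 3"
    "e 7 = - 2 * c - (p + q + r) - 1" "e 8 = - (a + b + c) - c - (p + q + r + g) - 2"
    "e 9 = - 2 * (a + b + c) - (p + q + r + g) - 3"
    by (simp_all add: exps)
  have "(\<Sum>i = 1..9. e i) = e 1 + e 2 + e 3 + e 4 + e 5 + e 6 + e 7 + e 8 + e 9"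
    by (simp add: numeral_eq_Suc)
  then have s: "(6 - (\<Sum>i = 1..9. e i)) / 3 = - r"
    by (simp only: e) simp
  define s11 s12 s13 s21 s22 s23 s31 s32 s33 where
    "s11 = e 1 + e 2 + e 3" and "s12 = e 4 + e 5 + e 6" and "s13 = e 7 + e 8 + e 9" and
    "s21 = e 1 * e 2 + e 1 * e 3 + e 2 * e 3" and "s22 = e 4 * e 5 + e 4 * e 6 + e 5 * e 6" and
    "s23 = e 7 * e 8 + e 7 * e 9 + e 8 * e 9" and
    "s31 = e 1 * e 2 * e 3" and "s32 = e 4 * e 5 * e 6" and "s33 = e 7 * e 8 * e 9"
  note s_def = s11_def s12_def s13_def s21_def s22_def s23_def s31_def s32_def s33_def
  define T11 where "T11 = - 8 + (s11^2 + 2 * s11 * s13 - s12^2 + s13^2) / 3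
            + s11 - 5 * s13 - s21 + s22 - 2 * s23"
  define T21 where "T21 = 35 + (- (s11^2) - 2 * s11 * s13 + s12^2 - s13^2) / 3
            - 7 * s11 + 5 * s13 + 2 * s21 - s22 + s23"
  define T10 where "T10 = ((2 * s11 + s11^2 + 2 * s11 * s13 - s12^2 + s13^2 - s11 * s21 + 2 * s11 * s23
              + s12 * s22 - 2 * s13 * s21 + 2 * s13 * s22 + s13 * s23 - 14 * s13) / 3
             + 2 * (s11^2 * s13 - s12^2 * s13) / 9
             + 2 * (s11^3 - s12^3) / 27
             - 5 - s21 + s31 + s22 - s32 - 5 * s23 - 3 * s33) / 2"
  define T20 where "T20 = - T10 + 19
            + (s11^2 * s13 - s11 * s12^2 + s11 * s13^2 - s12^2 * s13) / 9
            + (s13^3 + s11^3 - 2 * s12^3) / 27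
            + (- 2 * s11^2 - 4 * s11 * s13 + s11 * s22 + 2 * s12^2 + s22 * s12
               - 2 * s13^2 + s22 * s13) / 3
            - 5 * s11 + 4 * s13 + 3 * s21 - 2 * s22 - s31 - s32 - s33"
  \<comment> \<open>The value at \<open>\<theta> = w\<close> of the cubic that remains in
    \<open>conv_coeff r 3 i\<close> beside the product over \<open>k\<close>.\<close>
  define f where "f i w = SE3_coeff a b c g (of_nat i - 1 - r + w - p - q) (of_nat i - 1 - r + w - p) i" for i w
  note f_defs = f_def SE3_coeff_def Let_def
  \<comment> \<open>Half of \<open>f 1 1 - f 1 (- 1)\<close> is the sum of the linear and the cubic
    coefficient; the latter is - 3.\<close>
  have T11: "T11 = (f 1 1 - f 1 (- 1)) / 2 + 3"
  proof -
    \<comment> \<open>Clearing denominators leaves a polynomial identity.\<close>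
    have "6 * T11 = 2 * (- 24 + (s11^2 + 2 * s11 * s13 - s12^2 + s13^2)
            + 3 * (s11 - 5 * s13 - s21 + s22 - 2 * s23))"
      by (simp add: T11_def)
    also have "\<dots> = 6 * ((f 1 1 - f 1 (- 1)) / 2 + 3)"
      unfolding s_def e by (simp add: f_defs) algebra
    finally show ?thesis by (simp only: mult_cancel_left) simp
  qed
  have T10: "T10 = f 1 0"
  proof -
    have "54 * T10 = 9 * (2 * s11 + s11^2 + 2 * s11 * s13 - s12^2 + s13^2 - s11 * s21 + 2 * s11 * s23
              + s12 * s22 - 2 * s13 * s21 + 2 * s13 * s22 + s13 * s23 - 14 * s13)
             + 6 * (s11^2 * s13 - s12^2 * s13)
             + 2 * (s11^3 - s12^3)
             + 27 * (- 5 - s21 + s31 + s22 - s32 - 5 * s23 - 3 * s33)"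
      by (simp add: T10_def field_simps)
    also have "\<dots> = 54 * f 1 0"
      unfolding s_def e by (simp add: f_defs) algebra
    finally show ?thesis by simp
  qed
  have T21: "T21 = (f 2 1 - f 2 (- 1)) / 2 - 3"
  proof -
    have "6 * T21 = 2 * (105 + (- (s11^2) - 2 * s11 * s13 + s12^2 - s13^2)
            + 3 * (- 7 * s11 + 5 * s13 + 2 * s21 - s22 + s23))"
      by (simp add: T21_def)
    also have "\<dots> = 6 * ((f 2 1 - f 2 (- 1)) / 2 - 3)"
      unfolding s_def e by (simp add: f_defs) algebra
    finally show ?thesis by (simp only: mult_cancel_left) simp
  qed
  have T20: "T20 = f 2 0"
  proof -
    have "27 * T20 = - 27 * T10 + 513
            + 3 * (s11^2 * s13 - s11 * s12^2 + s11 * s13^2 - s12^2 * s13)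
            + (s13^3 + s11^3 - 2 * s12^3)
            + 9 * (- 2 * s11^2 - 4 * s11 * s13 + s11 * s22 + 2 * s12^2 + s22 * s12
               - 2 * s13^2 + s22 * s13)
            + 27 * (- 5 * s11 + 4 * s13 + 3 * s21 - 2 * s22 - s31 - s32 - s33)"
      by (simp add: T20_def field_simps)
    also have "\<dots> = 27 * f 2 0"
      unfolding s_def e T10 by (simp add: f_defs) algebra
    finally show ?thesis by simp
  qed
  have f1: "T10 + w * (T11 + w * (- 9 + s11 - 2 * s13 - w * 3)) = f 1 w" for w
  proof -
    have "2 * T10 + w * (2 * T11 + w * (2 * (- 9 + s11 - 2 * s13 - w * 3))) = 2 * f 1 w"
      unfolding T10 T11 s_def e by (simp add: f_defs) algebra
    then have "2 * (T10 + w * (T11 + w * (- 9 + s11 - 2 * s13 - w * 3))) = 2 * f 1 w"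
      by algebra
    then show ?thesis by (simp only: mult_cancel_left) simp
  qed
  have f2: "T20 + w * (T21 + w * (18 + s13 - 2 * s11 + w * 3)) = f 2 w" for w
  proof -
    have "2 * T20 + w * (2 * T21 + w * (2 * (18 + s13 - 2 * s11 + w * 3))) = 2 * f 2 w"
      unfolding T20 T21 s_def e by (simp add: f_defs) algebra
    then have "2 * (T20 + w * (T21 + w * (18 + s13 - 2 * s11 + w * 3))) = 2 * f 2 w"
      by algebra
    then show ?thesis by (simp only: mult_cancel_left) simp
  qed
  let ?f = "conv_coeff r 3"
  have "SE6 a b c g p q r
    = theta_poly ([:- r + 2, 1:] * [:- r + 1, 1:] * [:- r, 1:] * [:e 7, 1:] * [:e 8, 1:] * [:e 9, 1:])
      + theta_poly ([:- r + 2, 1:] * [:- r + 1, 1:] * [:T10, T11, - 9 + s11 - 2 * s13, - 3:]) * \<partial>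
      + theta_poly ([:- r + 2, 1:] * [:T20, T21, 18 + s13 - 2 * s11, 3:]) * \<partial> ^ 2
      + theta_poly (- ([:3 - e 1, 1:] * [:3 - e 2, 1:] * [:3 - e 3, 1:])) * \<partial> ^ 3"
    unfolding SE6_def E6_def Let_def e_def[symmetric] s s_def[symmetric] T11_def[symmetric]
      T10_def[symmetric] T21_def[symmetric] T20_def[symmetric]
    by (simp only: theta_plus_const theta_cubic theta_poly_mult theta_poly_uminus)
  also have "[:- r + 2, 1:] * [:- r + 1, 1:] * [:- r, 1:] * [:e 7, 1:] * [:e 8, 1:] * [:e 9, 1:]
      = ?f 0 (SE3_poly a b c g p q 0)"
    by (subst poly_eq_poly_eq_iff[symmetric], rule ext)
      (simp add: conv_coeff_def poly_pcompose poly_SE3_poly SE3_coeff_def Let_def poly_prod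
        numeral_3_eq_3 e, algebra)
  also have "[:- r + 2, 1:] * [:- r + 1, 1:] * [:T10, T11, - 9 + s11 - 2 * s13, - 3:]
      = ?f 1 (SE3_poly a b c g p q 1)"
  proof (subst poly_eq_poly_eq_iff[symmetric], rule ext)
    fix w
    have "poly ([:- r + 2, 1:] * [:- r + 1, 1:] * [:T10, T11, - 9 + s11 - 2 * s13, - 3:]) w
        = (w - r + 2) * (w - r + 1) * (T10 + w * (T11 + w * (- 9 + s11 - 2 * s13 - w * 3)))"
      by (simp add: algebra_simps)
    also have "\<dots> = poly (?f 1 (SE3_poly a b c g p q 1)) w"
      unfolding f1 f_def
      by (simp add: conv_coeff_def poly_pcompose poly_SE3_poly poly_prod numeral_3_eq_3 algebra_simps)
    finally show "poly ([:- r + 2, 1:] * [:- r + 1, 1:] * [:T10, T11, - 9 + s11 - 2 * s13, - 3:]) w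
        = poly (?f 1 (SE3_poly a b c g p q 1)) w" .
  qed
  also have "[:- r + 2, 1:] * [:T20, T21, 18 + s13 - 2 * s11, 3:] = ?f 2 (SE3_poly a b c g p q 2)"
  proof (subst poly_eq_poly_eq_iff[symmetric], rule ext)
    fix w
    have "poly ([:- r + 2, 1:] * [:T20, T21, 18 + s13 - 2 * s11, 3:]) w
        = (w - r + 2) * (T20 + w * (T21 + w * (18 + s13 - 2 * s11 + w * 3)))"
      by (simp add: algebra_simps)
    also have "\<dots> = poly (?f 2 (SE3_poly a b c g p q 2)) w"
      unfolding f2 f_def
      by (simp add: conv_coeff_def poly_pcompose poly_SE3_poly poly_prod numeral_3_eq_3 algebra_simps)
    finally show "poly ([:- r + 2, 1:] * [:T20, T21, 18 + s13 - 2 * s11, 3:]) w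
        = poly (?f 2 (SE3_poly a b c g p q 2)) w" .
  qed
  also have "- ([:3 - e 1, 1:] * [:3 - e 2, 1:] * [:3 - e 3, 1:]) = ?f 3 (SE3_poly a b c g p q 3)"
    by (subst poly_eq_poly_eq_iff[symmetric], rule ext)
      (simp add: conv_coeff_def poly_pcompose poly_SE3_poly SE3_coeff_def Let_def e e(1)[unfolded One_nat_def], algebra)
  finally show ?thesis
    by (simp add: conv_op_def numeral_3_eq_3 numeral_2_eq_2)
qed

section \<open>Reducibility\<close>

lemma complex_of_int_periodic:
  fixes P :: "complex \<Rightarrow> bool"
  assumes "\<And>x. P x \<longleftrightarrow> P (x + 1)"
  shows "P x \<longleftrightarrow> P (x + of_int n)"
proof (induction n rule: int_induct[where k = 0])
  case (step1 n)
  then show ?case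
    using assms[of "x + of_int n"] by (simp add: add.assoc)
next
  case (step2 n)
  then show ?case
    using assms[of "x + of_int (n - 1)"] by (simp add: algebra_simps)
qed simp

lemma SE6_reducible_shift_r: "dop_reducible (SE6 a b c g p q r) \<longleftrightarrow> dop_reducible (SE6 a b c g p q (r + of_int n))"
  by (rule complex_of_int_periodic)
    (use reducible_shift_r[of "_ + 1"] in \<open>simp add: SE6_eq_conv_op\<close>)

lemma SE6_reducible_shift_p: "dop_reducible (SE6 a b c g p q r) \<longleftrightarrow> dop_reducible (SE6 a b c g (p + of_int n) q r)"
proof (rule complex_of_int_periodic)
  show "dop_reducible (SE6 a b c g p q r) \<longleftrightarrow> dop_reducible (SE6 a b c g (p + 1) q r)" for p
    using reducible_shift_p[of r a b c g p q] SE6_reducible_shift_r[of a b c g "p + 1" q r "- 1"]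
    by (simp add: SE6_eq_conv_op)
qed

lemma SE6_reducible_shift_q: "dop_reducible (SE6 a b c g p q r) \<longleftrightarrow> dop_reducible (SE6 a b c g p (q + of_int n) r)"
proof (rule complex_of_int_periodic)
  show "dop_reducible (SE6 a b c g p q r) \<longleftrightarrow> dop_reducible (SE6 a b c g p (q + 1) r)" for q
    using reducible_shift_q[of r a b c g p q] SE6_reducible_shift_r[of a b c g p "q + 1" r "- 1"]
    by (simp add: SE6_eq_conv_op)
qed

text \<open>The contiguity relation for \<open>c\<close> also moves \<open>p\<close>,
  \<open>q\<close> and \<open>r\<close> by integers, which the preceding shifts undo.\<close>

lemma SE6_reducible_shift_c: "dop_reducible (SE6 a b c g p q r) \<longleftrightarrow> dop_reducible (SE6 a b (c + of_int n) g p q r)"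
proof (rule complex_of_int_periodic)
  show "dop_reducible (SE6 a b c g p q r) \<longleftrightarrow> dop_reducible (SE6 a b (c + 1) g p q r)" for c
    using reducible_shift_c[of r a b "c + 1" g p q]
      SE6_reducible_shift_r[of a b c g "p + 2" "q + 2" r "- 2"]
      SE6_reducible_shift_p[of a b c g p "q + 2" r 2] SE6_reducible_shift_q[of a b c g p q r 2]
    by (simp add: SE6_eq_conv_op)
qed

lemma SE6_reducible_shift_g:
  assumes "g \<noteq> - 1" "2 * b + g + 2 \<noteq> 0"
  shows "dop_reducible (SE6 a b c g p q r) \<longleftrightarrow> dop_reducible (SE6 a b c (g + 2) p q r)"
  using reducible_shift_g[OF assms, of r a c p q] SE6_reducible_shift_r[of a b c "g + 2" p q r "- 2"]
  by (simp add: SE6_eq_conv_op)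

text \<open>Reversing the order of the exponents at \<open>0\<close>, at \<open>1\<close> or at infinity yields the same operator.\<close>

lemma SE6_reverse:
  "SE6 (- c - h - 1) (a + b + c + h + 1) (- a - h - 1) (2 * h) (p + 2 * (a + c + h + 1)) q r = SE6 a b c (2 * h) p q r"
  "SE6 (a + b + c + h + 1) (- c - h - 1) (- b - h - 1) (2 * h) p (q + 2 * (b + c + h + 1)) r = SE6 a b c (2 * h) p q r"
  "SE6 (- b - h - 1) (- a - h - 1) (a + b + c + h + 1) (2 * h) p q r = SE6 a b c (2 * h) p q r"
  unfolding SE6_eq_conv_op
  by (rule conv_op_cong, drule le_numeral_cases(2), subst poly_eq_poly_eq_iff[symmetric], rule ext,
      elim disjE; hypsubst; (simp add: poly_SE3_poly SE3_coeff_def Let_def, algebra?))+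

lemma SE6_reducible_c:
  assumes "c \<in> \<int>"
  shows "dop_reducible (SE6 a b c g p q r)"
proof -
  from assms obtain n where "c = 0 + of_int n"
    by (auto elim: Ints_cases)
  then show ?thesis
    using SE6_reducible_shift_c[of a b 0 g p q r n] reducible_c_0[of r a b g p q]
    by (simp add: SE6_eq_conv_op)
qed

lemma Ints_minus_diff_1: "- a - h - 1 \<in> \<int> \<longleftrightarrow> a + h + (1::complex) \<in> \<int>"
proof -
  have "- a - h - 1 = - (a + h + 1)"
    by simp
  then show ?thesis
    by (simp only: minus_in_Ints_iff)
qed

text \<open>The reversals permute the conditions transitively.\<close>

lemma SE6_reducible_SE3:
  assumes "a \<in> \<int> \<or> b \<in> \<int> \<or> c \<in> \<int> \<or> a + h + 1 \<in> \<int> \<or> b + h + 1 \<in> \<int> \<or> c + h + 1 \<in> \<int>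
    \<or> a + b + c + h + 1 \<in> \<int> \<or> a + b + c + 2 * h + 2 \<in> \<int>"
  shows "dop_reducible (SE6 a b c (2 * h) p q r)"
proof -
  \<comment> \<open>Each reversal puts a new expression in the place of \<open>c\<close>; this gives
    \<open>ah\<close>, \<open>bh\<close> and \<open>dh\<close>.\<close>
  have ah: "dop_reducible (SE6 a b c (2 * h) p q r)" if "a + h + 1 \<in> \<int>" for a b c p q
  proof -
    have "dop_reducible (SE6 (- c - h - 1) (a + b + c + h + 1) (- a - h - 1) (2 * h) (p + 2 * (a + c + h + 1)) q r)"
      using that by (intro SE6_reducible_c) (simp only: Ints_minus_diff_1)
    then show ?thesis
      by (simp only: SE6_reverse)
  qed
  have bh: "dop_reducible (SE6 a b c (2 * h) p q r)" if "b + h + 1 \<in> \<int>" for a b c p q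
  proof -
    have "dop_reducible (SE6 (a + b + c + h + 1) (- c - h - 1) (- b - h - 1) (2 * h) p (q + 2 * (b + c + h + 1)) r)"
      using that by (intro SE6_reducible_c) (simp only: Ints_minus_diff_1)
    then show ?thesis
      by (simp only: SE6_reverse)
  qed
  have dh: "dop_reducible (SE6 a b c (2 * h) p q r)" if "a + b + c + h + 1 \<in> \<int>" for a b c p q
  proof -
    have "dop_reducible (SE6 (- b - h - 1) (- a - h - 1) (a + b + c + h + 1) (2 * h) p q r)"
      using that by (intro SE6_reducible_c) assumption
    then show ?thesis
      by (simp only: SE6_reverse)
  qed
  \<comment> \<open>Reversal at infinity turns the condition of \<open>ah\<close> into integrality
    of \<open>- b\<close>.\<close>
  have b: "dop_reducible (SE6 a b c (2 * h) p q r)" if "b \<in> \<int>" for a b c p q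
  proof -
    have "dop_reducible (SE6 (- b - h - 1) (- a - h - 1) (a + b + c + h + 1) (2 * h) p q r)"
      using that by (intro ah) (simp add: minus_in_Ints_iff)
    then show ?thesis
      by (simp only: SE6_reverse)
  qed
  have a: "dop_reducible (SE6 a b c (2 * h) p q r)" if "a \<in> \<int>" for a b c p q
  proof -
    have "dop_reducible (SE6 (- b - h - 1) (- a - h - 1) (a + b + c + h + 1) (2 * h) p q r)"
      using that by (intro bh) (simp add: minus_in_Ints_iff)
    then show ?thesis
      by (simp only: SE6_reverse)
  qed
  have ch: "dop_reducible (SE6 a b c (2 * h) p q r)" if "c + h + 1 \<in> \<int>" for a b c p q
  proof -
    have "dop_reducible (SE6 (- c - h - 1) (a + b + c + h + 1) (- a - h - 1) (2 * h) (p + 2 * (a + c + h + 1)) q r)"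
      using that by (intro a) (simp only: Ints_minus_diff_1)
    then show ?thesis
      by (simp only: SE6_reverse)
  qed
  \<comment> \<open>After reversal at 0 the second argument is \<open>a + b + c + h + 1\<close>, so
    \<open>bh\<close> adds another \<open>h + 1\<close>.\<close>
  have dg: "dop_reducible (SE6 a b c (2 * h) p q r)" if "a + b + c + 2 * h + 2 \<in> \<int>" for a b c p q
  proof -
    have "dop_reducible (SE6 (- c - h - 1) (a + b + c + h + 1) (- a - h - 1) (2 * h) (p + 2 * (a + c + h + 1)) q r)"
      using that by (intro bh) (simp add: algebra_simps)
    then show ?thesis
      by (simp only: SE6_reverse)
  qed
  show ?thesis
    by (insert assms, elim disjE; (erule a | erule b | erule SE6_reducible_c | erule ah | erule bh
          | erule ch | erule dh | erule dg))
qed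

text \<open>The step from \<open>g = - 1\<close> to \<open>g = 1\<close> may be degenerate, so each sign of \<open>g\<close> has its own base case.\<close>

lemma SE6_reducible_g_odd: "dop_reducible (SE6 a b c (2 * of_int n + 1) p q r)"
proof (cases "b + (of_int n + 1 / 2) + 1 \<in> \<int>")
  case True
  then show ?thesis
    using SE6_reducible_SE3[of a b c "of_int n + 1 / 2" p q r] by (simp add: algebra_simps)
next
  case False
  \<comment> \<open>Outside the case settled by \<open>SE6_reducible_SE3\<close>, the second
    hypothesis of \<open>SE6_reducible_shift_g\<close> holds along the whole chain of odd
    \<open>g\<close>.\<close>
  have b: "2 * b + (2 * of_int m + 1) + 2 \<noteq> 0" for m
  proof
    assume "2 * b + (2 * of_int m + 1) + 2 = 0"
    then have "b + (of_int n + 1 / 2) + 1 = of_int (n - m)"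
      by (simp add: field_simps)
    with False show False
      by simp
  qed
  have shift: "dop_reducible (SE6 a b c (2 * of_int m + 1) p q r)
      \<longleftrightarrow> dop_reducible (SE6 a b c (2 * of_int (m + 1) + 1) p q r)" if "m \<noteq> - 1" for m
  proof -
    have "2 * of_int m + 1 \<noteq> (- 1 :: complex)"
    proof
      assume "2 * of_int m + 1 = (- 1 :: complex)"
      then have "of_int (2 * m + 2) = (0 :: complex)"
        by (simp add: add.commute)
      with that show False
        by (simp only: of_int_eq_0_iff)
    qed
    then show ?thesis
      using SE6_reducible_shift_g[of "2 * of_int m + 1" b a c p q r] b[of m]
      by (simp add: algebra_simps)
  qed
  show ?thesis
  proof (cases "n \<ge> 0")
    case True
    then show ?thesis
    proof (induction n rule: int_ge_induct)
      case base
      then show ?case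
        by (simp add: SE6_eq_conv_op reducible_g_1)
    next
      case (step m)
      then show ?case
        using shift[of m] by simp
    qed
  next
    case False
    then have "n \<le> - 1"
      by simp
    then show ?thesis
    proof (induction n rule: int_le_induct)
      case base
      then show ?case
        by (simp add: SE6_eq_conv_op reducible_g_minus_1)
    next
      case (step m)
      then show ?case
        using shift[of "m - 1"] by simp
    qed
  qed
qed

text \<open>The numbers \<open>p + t\<close> are the exponents at 0 before convolution. Shifting
  \<open>p\<close> to \<open>- t\<close> makes one vanish, so the last coefficient is divisible by
  \<theta> and \<open>conv_op_left_factor\<close> applies.\<close>

lemma SE6_reducible_p:
  assumes "p + t \<in> \<int>" "t \<in> {0, a + c + 1, 2 * a + 2 * c + g + 2}"
  shows "dop_reducible (SE6 a b c g p q r)"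
proof -
  obtain n where n: "p + t = of_int n"
    using assms(1) by (elim Ints_cases)
  have "poly (SE3_poly a b c g (- t) q 3) 0 = 0"
    using assms(2) by (auto simp: poly_SE3_poly SE3_coeff_def Let_def)
  then have "[:0, 1:] dvd SE3_poly a b c g (- t) q (Suc 2)"
    by (simp add: poly_eq_0_iff_dvd numeral_3_eq_3)
  then obtain G where G: "conv_op r (Suc 2) (SE3_poly a b c g (- t) q) = theta_poly [:of_nat 2 - r, 1:] * G"
    by (rule conv_op_left_factor)
  have "dop_order (theta_poly [:of_nat 2 - r, 1:]) \<le> 1"
    using dop_order_theta_poly_le[of "[:of_nat 2 - r, 1:]"] by simp
  moreover have "coeff (symbol (theta_poly [:of_nat 2 - r, 1:])) 1 \<noteq> 0"
    by (subst coeff_symbol_theta_poly) (simp_all add: Zero_fract_def eq_fract)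
  ultimately have "dop_order (theta_poly [:of_nat 2 - r, 1:]) = 1"
    by (metis dop_order.rep_eq le_antisym le_degree)
  moreover have "SE6 a b c g (- t) q r = theta_poly [:of_nat 2 - r, 1:] * G"
    using G by (simp only: SE6_eq_conv_op numeral_3_eq_3 numeral_2_eq_2)
  ultimately have "dop_reducible (SE6 a b c g (- t) q r)"
    using dop_order_SE3_conv[of r a b c g "- t" q]
    by (intro reducible_if_first_order_factor[of _ "theta_poly [:of_nat 2 - r, 1:]" G])
      (simp_all only: SE6_eq_conv_op, simp_all)
  moreover have "- t + of_int n = p"
    using n[symmetric] by simp
  ultimately show ?thesis
    using SE6_reducible_shift_p[of a b c g "- t" q r n] by simp
qed

lemma SE6_reducible_q:
  assumes "q + t \<in> \<int>" "t \<in> {0, b + c + 1, 2 * b + 2 * c + g + 2}"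
  shows "dop_reducible (SE6 a b c g p q r)"
proof -
  obtain n where n: "q + t = of_int n"
    using assms(1) by (elim Ints_cases)
  have "dop_reducible (SE6 a b c g p (- t) r)"
    unfolding SE6_eq_conv_op using assms(2) by (intro reducible_q_exponent_0) auto
  moreover have "- t + of_int n = q"
    using n[symmetric] by simp
  ultimately show ?thesis
    using SE6_reducible_shift_q[of a b c g p "- t" r n] by simp
qed

text \<open>After shifting \<open>r\<close> to \<open>- t\<close>, the constant functions are
  solutions, so \<partial> splits off on the right. The value \<open>t = 0\<close> uses the product
  in \<open>conv_coeff\<close>, the others the exponents at infinity.\<close>

lemma SE6_reducible_r:
  assumes "r + t \<in> \<int>" "t \<in> {0, p + q + 2 * c + 1, p + q + a + b + 2 * c + g + 2, p + q + 2 * (a + b + c) + g + 3}"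
  shows "dop_reducible (SE6 a b c g p q r)"
proof -
  obtain n where n: "r + t = of_int n"
    using assms(1) by (elim Ints_cases)
  have "poly (conv_coeff (- t) 3 0 (SE3_poly a b c g p q 0)) 0 = 0"
    using assms(2) by (auto simp: conv_coeff_def poly_prod poly_pcompose poly_SE3_poly SE3_coeff_def
        Let_def numeral_3_eq_3)
  then obtain G where G: "conv_op (- t) 3 (SE3_poly a b c g p q) = G * \<partial>"
    by (rule conv_op_right_factor)
  have "dop_order \<partial> = 1"
    using dop_order_simps(3)[of 1] by simp
  with G have "dop_reducible (SE6 a b c g p q (- t))"
    using dop_order_SE3_conv[of "- t" a b c g p q] unfolding SE6_eq_conv_op
    by (intro reducible_if_first_order_factor[of _ G \<partial>]) simp_all
  moreover have "- t + of_int n = r"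
    using n[symmetric] by simp
  ultimately show ?thesis
    using SE6_reducible_shift_r[of a b c g p q "- t" n] by simp
qed

theorem theorem5p10:
  fixes a b c g p q r \<delta> :: complex and e :: "nat \<Rightarrow> complex"
  defines "\<delta> \<equiv> a + b + c"
    and "e \<equiv> SE6_exps a b c g p q r"
  assumes "- a \<in> \<int> \<or> - b \<in> \<int> \<or> - c \<in> \<int>
    \<or> a + g / 2 + 1 \<in> \<int> \<or> b + g / 2 + 1 \<in> \<int> \<or> c + g / 2 + 1 \<in> \<int>
    \<or> - (\<delta> + g / 2 + 1) \<in> \<int> \<or> \<delta> + g + 2 \<in> \<int> \<or> 1 / 2 - g / 2 \<in> \<int>
    \<or> (\<exists>i\<in>{1..6}. e i - r \<in> \<int>)
    \<or> e 7 \<in> \<int> \<or> e 8 \<in> \<int> \<or> e 9 \<in> \<int> \<or> r \<in> \<int>"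
  shows "dop_reducible (SE6 a b c g p q r)"
proof -
  note exps = e_def SE6_exps_def Let_def
  have e6: "{1..6} = {1, 2, 3, 4, 5, 6::nat}"
    by auto
  \<comment> \<open>For \<open>i\<close> up to 6, \<open>e i - r\<close> exceeds an exponent
    \<open>p + t\<close> or \<open>q + t\<close> by 1.\<close>
  have shift: "x \<in> \<int>" if "x + 1 \<in> \<int>" for x :: complex
    using Ints_diff[OF that Ints_1] by simp
  have e_p: "dop_reducible (SE6 a b c g p q r)"
    if "e 1 - r \<in> \<int> \<or> e 2 - r \<in> \<int> \<or> e 3 - r \<in> \<int>"
  proof -
    have "e 1 - r = p + 0 + 1" "e 2 - r = p + (a + c + 1) + 1"
      "e 3 - r = p + (2 * a + 2 * c + g + 2) + 1"
      by (simp_all add: exps)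
    with that show ?thesis
      using SE6_reducible_p shift by (metis insertCI)
  qed
  have e_q: "dop_reducible (SE6 a b c g p q r)"
    if "e 4 - r \<in> \<int> \<or> e 5 - r \<in> \<int> \<or> e 6 - r \<in> \<int>"
  proof -
    have "e 4 - r = q + 0 + 1" "e 5 - r = q + (b + c + 1) + 1"
      "e 6 - r = q + (2 * b + 2 * c + g + 2) + 1"
      by (simp_all add: exps)
    with that show ?thesis
      using SE6_reducible_q shift by (metis insertCI)
  qed
  have e_inf: "dop_reducible (SE6 a b c g p q r)"
    if "e 7 \<in> \<int> \<or> e 8 \<in> \<int> \<or> e 9 \<in> \<int> \<or> r \<in> \<int>"
  proof -
    have "e 7 = - (r + (p + q + 2 * c + 1))" "e 8 = - (r + (p + q + a + b + 2 * c + g + 2))"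
      "e 9 = - (r + (p + q + 2 * (a + b + c) + g + 3))" "r = r + 0"
      by (simp_all add: exps)
    with that show ?thesis
      using SE6_reducible_r minus_in_Ints_iff by (metis insertCI)
  qed
  have g: "dop_reducible (SE6 a b c g p q r)" if half: "1 / 2 - g / 2 \<in> \<int>"
  proof -
    obtain n where "1 / 2 - g / 2 = of_int n"
      using half by (elim Ints_cases)
    then have "g = 2 * of_int (- n) + 1"
      by (simp add: field_simps)
    then show ?thesis
      using SE6_reducible_g_odd by metis
  qed
  have "dop_reducible (SE6 a b c g p q r)"
    if "a \<in> \<int> \<or> b \<in> \<int> \<or> c \<in> \<int> \<or> a + g / 2 + 1 \<in> \<int> \<or> b + g / 2 + 1 \<in> \<int> \<or> c + g / 2 + 1 \<in> \<int>
      \<or> \<delta> + g / 2 + 1 \<in> \<int> \<or> \<delta> + g + 2 \<in> \<int>"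
    using SE6_reducible_SE3[of a b c "g / 2" p q r] that by (simp add: \<delta>_def)
  then show ?thesis
    using assms(3) e_p e_q e_inf g unfolding e6 minus_in_Ints_iff by blast
qed

end
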